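(* The set of bounded datalog programs is recursively enumerable.
   Context: Datalog programs are standard positive datalog programs (finite sets of rules $q(\bar s)\gets p_1(\bar s_1),\dots,p_\mu(\bar s_\mu)$, terms being variables or constants). A predicate is IDB if it is the head predicate of a rule with non-empty body, otherwise EDB. A datalog program is bounded if there is a finite non-recursive datalog program equivalent to it, i.e. computing the same IDB relations on every EDB instance. *)

theory Defs
  imports Main "HOL-Library.Nat_Bijection"
begin

section \<open>Datalog programs\<close>

text \<open>
  Variables, constants and predicate names are taken from countably infinite supplies,
  represented by \<^typ>\<open>nat\<close>. A predicate symbol is a name together with an arity (as in
  the notation \<open>p/n\<close> of logic programming); the symbol of an atom is read off from the
  atom, so that atoms always respect arities.
\<close>

datatype tm = Var nat | Const nat

datatype atom = Atom (aname: nat) (args: "tm list")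

datatype rule = Rule (head: atom) (body: "atom list")

type_synonym program = "rule set"

type_synonym psym = "nat \<times> nat"

type_synonym fact = "nat \<times> nat list"

definition atom_sym :: "atom \<Rightarrow> psym" where
  "atom_sym a = (aname a, length (args a))"

definition fact_sym :: "fact \<Rightarrow> psym" where
  "fact_sym F = (fst F, length (snd F))"

definition datalog_program :: "program \<Rightarrow> bool" where
  "datalog_program P \<longleftrightarrow> finite P"

definition idb :: "program \<Rightarrow> psym set" where
  "idb P = {atom_sym (head r) | r. r \<in> P \<and> body r \<noteq> []}"

definition edb_instance :: "program \<Rightarrow> fact set \<Rightarrow> bool" where
  "edb_instance P D \<longleftrightarrow> finite D \<and> (\<forall>F\<in>D. fact_sym F \<notin> idb P)"

text \<open>
  Variables range over the set of all constants. No safety condition is imposed on rules; for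
  rules whose head variables all occur in the body, this agrees with the active domain semantics.
\<close>

fun tm_val :: "(nat \<Rightarrow> nat) \<Rightarrow> tm \<Rightarrow> nat" where
  "tm_val \<sigma> (Var x) = \<sigma> x"
| "tm_val \<sigma> (Const c) = c"

definition ground :: "(nat \<Rightarrow> nat) \<Rightarrow> atom \<Rightarrow> fact" where
  "ground \<sigma> a = (aname a, map (tm_val \<sigma>) (args a))"

inductive_set consequences :: "program \<Rightarrow> fact set \<Rightarrow> fact set"
  for P :: program and D :: "fact set" where
  base: "F \<in> D \<Longrightarrow> F \<in> consequences P D"
| step: "r \<in> P \<Longrightarrow> (\<And>a. a \<in> set (body r) \<Longrightarrow> ground \<sigma> a \<in> consequences P D)
    \<Longrightarrow> ground \<sigma> (head r) \<in> consequences P D"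

definition computed_relation :: "program \<Rightarrow> fact set \<Rightarrow> psym \<Rightarrow> nat list set" where
  "computed_relation P D q = {cs. (fst q, cs) \<in> consequences P D \<and> length cs = snd q}"

definition dependency :: "program \<Rightarrow> (psym \<times> psym) set" where
  "dependency P = {(atom_sym (head r), atom_sym a) | r a. r \<in> P \<and> a \<in> set (body r)}"

definition nonrecursive :: "program \<Rightarrow> bool" where
  "nonrecursive P \<longleftrightarrow> acyclic (dependency P)"

text \<open>
  The second program may have no rule with a non-empty body for some IDB predicate of the first:
  the predicate \<open>p\<close> of \<open>p(x) \<leftarrow> p(x)\<close> is always empty, and it is
  computed by the empty program, whereas any non-recursive program with a rule for \<open>p\<close> with a
  non-empty body makes \<open>p\<close> non-empty on some instance. Hence only an inclusion of the IDB
  predicates is demanded. It ensures that the EDB predicates of the first program, and thus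
  the instances that are compared, are also extensional for the second. (Auxiliary predicates in a
  non-recursive program could be eliminated by unfolding.)
\<close>

definition equivalent_to :: "program \<Rightarrow> program \<Rightarrow> bool" where
  "equivalent_to P Q \<longleftrightarrow> idb Q \<subseteq> idb P \<and>
     (\<forall>D. edb_instance P D \<longrightarrow>
        (\<forall>q\<in>idb P. computed_relation P D q = computed_relation Q D q))"

definition bounded_program :: "program \<Rightarrow> bool" where
  "bounded_program P \<longleftrightarrow>
     (\<exists>Q. datalog_program Q \<and> nonrecursive Q \<and> equivalent_to P Q)"


section \<open>Recursively enumerable sets\<close>

datatype recf =
    Zero
  | Succ
  | Proj nat
  | Comp recf "recf list"
  | PrimRec recf recf
  | Minim recf

text \<open>
  \<open>rec_eval f xs y\<close>: the partial recursive function denoted by \<open>f\<close> is defined on the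
  argument tuple \<open>xs\<close> and has the value \<open>y\<close>. \<^const>\<open>Zero\<close> denotes the constant zero
  function of every arity; recursion and minimization act on the first argument.
\<close>

inductive rec_eval :: "recf \<Rightarrow> nat list \<Rightarrow> nat \<Rightarrow> bool" where
  Zero: "rec_eval Zero xs 0"
| Succ: "rec_eval Succ [x] (Suc x)"
| Proj: "i < length xs \<Longrightarrow> rec_eval (Proj i) xs (xs ! i)"
| Comp: "list_all2 (\<lambda>g y. rec_eval g xs y) gs ys \<Longrightarrow> rec_eval f ys z
    \<Longrightarrow> rec_eval (Comp f gs) xs z"
| PrimRec_0: "rec_eval f xs y \<Longrightarrow> rec_eval (PrimRec f g) (0 # xs) y"
| PrimRec_Suc: "rec_eval (PrimRec f g) (n # xs) r \<Longrightarrow> rec_eval g (n # r # xs) y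
    \<Longrightarrow> rec_eval (PrimRec f g) (Suc n # xs) y"
| Minim: "rec_eval f (n # xs) 0 \<Longrightarrow> (\<And>m. m < n \<Longrightarrow> \<exists>r. rec_eval f (m # xs) (Suc r))
    \<Longrightarrow> rec_eval (Minim f) xs n"

inductive_cases rec_evalE:
  "rec_eval Zero xs z" "rec_eval Succ xs z" "rec_eval (Proj i) xs z" "rec_eval (Comp f gs) xs z"
  "rec_eval (PrimRec f g) (0 # xs) z" "rec_eval (PrimRec f g) (Suc n # xs) z"
  "rec_eval (Minim f) xs z"

lemma rec_eval_functional: "rec_eval f xs y \<Longrightarrow> rec_eval f xs z \<Longrightarrow> y = z"
proof (induction arbitrary: z rule: rec_eval.induct)
  case (Zero xs)
  then show ?case by (rule rec_evalE(1)) simp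
next
  case (Succ x)
  then show ?case by (rule rec_evalE(2)) simp
next
  case (Proj i xs)
  from Proj.prems show ?case by (rule rec_evalE(3)) simp
next
  case (Comp xs gs ys f z')
  from Comp.prems obtain ys' where ys': "list_all2 (\<lambda>g y. rec_eval g xs y) gs ys'"
    and z: "rec_eval f ys' z"
    by (rule rec_evalE(4))
  have "ys = ys'"
  proof (rule nth_equalityI)
    show "length ys = length ys'"
      using list_all2_lengthD[OF Comp.IH(1)] list_all2_lengthD[OF ys'] by simp
    fix i assume "i < length ys"
    then have i: "i < length gs" using list_all2_lengthD[OF Comp.IH(1)] by simp
    show "ys ! i = ys' ! i"
      using list_all2_nthD[OF Comp.IH(1) i] list_all2_nthD[OF ys' i] by blast
  qed
  with z Comp.IH(2) show ?case by blast
next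
  case (PrimRec_0 f xs y g)
  from PrimRec_0.prems have "rec_eval f xs z" by (rule rec_evalE(5))
  with PrimRec_0.IH show ?case by blast
next
  case (PrimRec_Suc f g n xs r y)
  from PrimRec_Suc.prems obtain r' where "rec_eval (PrimRec f g) (n # xs) r'"
    and "rec_eval g (n # r' # xs) z"
    by (rule rec_evalE(6))
  with PrimRec_Suc.IH show ?case by blast
next
  case (Minim f n xs)
  from Minim.prems have z: "rec_eval f (z # xs) 0"
    by (rule rec_evalE(7))
  from Minim.prems have below: "\<exists>r. rec_eval f (m # xs) (Suc r)" if "m < z" for m
    by (rule rec_evalE(7)) (use that in blast)
  have "\<not> n < z"
  proof
    assume "n < z"
    with below obtain r where "rec_eval f (n # xs) (Suc r)" by blast
    with Minim.IH(1) have "0 = Suc r" by blast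
    then show False by simp
  qed
  moreover have "\<not> z < n"
  proof
    assume "z < n"
    with Minim.IH(2) z obtain r where "Suc r = 0" by blast
    then show False by simp
  qed
  ultimately show ?case by simp
qed

text \<open>A set of numbers is recursively enumerable iff it is the domain of a unary partial recursive
  function.\<close>

definition recursively_enumerable :: "nat set \<Rightarrow> bool" where
  "recursively_enumerable A \<longleftrightarrow> (\<exists>f. A = {n. \<exists>y. rec_eval f [n] y})"


section \<open>Coding of programs by natural numbers\<close>

fun tm_code :: "tm \<Rightarrow> nat" where
  "tm_code (Var x) = sum_encode (Inl x)"
| "tm_code (Const c) = sum_encode (Inr c)"

definition atom_code :: "atom \<Rightarrow> nat" where
  "atom_code a = prod_encode (aname a, list_encode (map tm_code (args a)))"

definition rule_code :: "rule \<Rightarrow> nat" where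
  "rule_code r = prod_encode (atom_code (head r), list_encode (map atom_code (body r)))"

text \<open>\<^const>\<open>set_encode\<close> is a bijection from the finite sets of numbers to the numbers.\<close>

definition program_code :: "program \<Rightarrow> nat" where
  "program_code P = set_encode (rule_code ` P)"

lemma inj_tm_code: "inj tm_code"
proof (rule injI)
  fix s t assume "tm_code s = tm_code t"
  then show "s = t"
    by (cases s; cases t) (auto dest: injD[OF inj_sum_encode])
qed

lemma inj_atom_code: "inj atom_code"
proof (rule injI)
  fix a b assume "atom_code a = atom_code b"
  then show "a = b"
    by (cases a; cases b) (simp add: atom_code_def list_encode_eq inj_map_eq_map[OF inj_tm_code])
qed

lemma inj_rule_code: "inj rule_code"
proof (rule injI)
  fix r s assume "rule_code r = rule_code s"
  then show "r = s"
    by (cases r; cases s)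
      (simp add: rule_code_def list_encode_eq inj_map_eq_map[OF inj_atom_code]
        inj_eq[OF inj_atom_code])
qed

lemma inj_on_program_code: "inj_on program_code {P. datalog_program P}"
  by (rule inj_onI)
    (auto simp: program_code_def datalog_program_def set_encode_eq
      inj_image_eq_iff[OF inj_rule_code])

end

theory Submission
  imports Defs
begin

text \<open>
  A program is bounded iff there is a \<open>k\<close> such that, on every instance, its immediate
  consequence operator is stationary after \<open>k\<close> rounds. A fact obtained in \<open>s\<close> rounds depends on
  boundedly many facts of the instance, so up to renaming of constants only finitely many pairs of a
  fact and a supporting instance occur. Hence a stationary program is captured by the finitely many
  conjunctive queries read off from these pairs, and an equivalent non-recursive program, which
  itself is stationary after some number of rounds, yields a common number of rounds for all of
  them. For the same reason stationarity after \<open>k\<close> rounds has to be tested only on the instances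
  over an initial segment of the constants, whose length is computable from \<open>k\<close> and the code of the
  program. So the bounded programs form the projection of a decidable relation.
\<close>

section \<open>Stages of the immediate consequence operator\<close>

text \<open>Enumerating non-recursive candidates and testing each for equivalence would mean
  comparing a recursive program with a union of conjunctive queries on all instances. Stationarity
  speaks of the given program alone, and for fixed \<open>k\<close> it is tested on finitely many
  finite instances. Two features of the semantics shape the details. Rules need not be safe, so a
  stage over a finite instance can be infinite and can involve constants that occur nowhere in the
  instance; the test looks only at facts over an initial segment, and a retraction onto the segment
  shows that nothing is lost. Rules mention constants, so every renaming must fix those of the
  program; the numbers below a bound \<open>N\<close> on them are reserved for this. Derivations
  survive non-injective renamings too, as bodies contain neither negation nor inequality, and so
  canonical copies transfer to arbitrary instances.\<close>

definition fmap :: "(nat \<Rightarrow> nat) \<Rightarrow> fact \<Rightarrow> fact" where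
  "fmap h F = (fst F, map h (snd F))"

lemma fmap_simps [simp]: "fst (fmap h F) = fst F" "snd (fmap h F) = map h (snd F)"
  by (simp_all add: fmap_def)

lemma fmap_fmap: "fmap g (fmap h F) = fmap (g \<circ> h) F"
  by (simp add: fmap_def)

lemma fmap_idI: "(\<And>c. c \<in> set (snd F) \<Longrightarrow> h c = c) \<Longrightarrow> fmap h F = F"
  by (simp add: fmap_def map_idI)

lemma fact_sym_fmap [simp]: "fact_sym (fmap h F) = fact_sym F"
  by (simp add: fact_sym_def)

lemma fact_sym_ground [simp]: "fact_sym (ground \<sigma> a) = atom_sym a"
  by (simp add: fact_sym_def ground_def atom_sym_def)

text \<open>The instance is added again in every round, which makes the stages increasing.
  Substitutions range over all of \<open>nat\<close>, so an unsafe rule can make a stage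
  infinite.\<close>

primrec stage :: "program \<Rightarrow> fact set \<Rightarrow> nat \<Rightarrow> fact set" where
  "stage P D 0 = D"
| "stage P D (Suc s) = D \<union>
    {ground \<sigma> (head r) | r \<sigma>. r \<in> P \<and> (\<forall>a\<in>set (body r). ground \<sigma> a \<in> stage P D s)}"

lemma stage_SucI:
  "r \<in> P \<Longrightarrow> (\<And>a. a \<in> set (body r) \<Longrightarrow> ground \<sigma> a \<in> stage P D s) \<Longrightarrow>
    ground \<sigma> (head r) \<in> stage P D (Suc s)"
  unfolding stage.simps by blast

lemma stage_SucE:
  assumes "F \<in> stage P D (Suc s)" "F \<notin> D"
  obtains r \<sigma> where "r \<in> P" "F = ground \<sigma> (head r)"
    "\<And>a. a \<in> set (body r) \<Longrightarrow> ground \<sigma> a \<in> stage P D s"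
  using assms unfolding stage.simps by blast

lemma stage_Suc_subset: "stage P D s \<subseteq> stage P D (Suc s)"
proof (induction s)
  case (Suc s)
  then show ?case by (simp only: stage.simps) blast
qed simp

lemma stage_mono_index: "s \<le> t \<Longrightarrow> stage P D s \<subseteq> stage P D t"
  by (rule lift_Suc_mono_le[of "stage P D"]) (rule stage_Suc_subset)

lemma stage_mono_db: "D \<subseteq> E \<Longrightarrow> stage P D s \<subseteq> stage P E s"
proof (induction s)
  case (Suc s)
  then show ?case by (simp only: stage.simps) blast
qed simp

lemma stage_subset_consequences: "stage P D s \<subseteq> consequences P D"
proof (induction s)
  case (Suc s)
  show ?case
  proof
    fix F assume "F \<in> stage P D (Suc s)"
    then show "F \<in> consequences P D"
    proof (cases "F \<in> D")
      case False
      from stage_SucE[OF \<open>F \<in> stage P D (Suc s)\<close> this] show ?thesis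
        using Suc consequences.step by (metis subsetD)
    qed (rule consequences.base)
  qed
qed (auto intro: consequences.base)

text \<open>A stationary stage contains \<open>D\<close> and is closed under the rules, and
  \<open>consequences\<close> is the least such set.\<close>

lemma consequences_subset_stage:
  assumes "stage P D (Suc s) \<subseteq> stage P D s"
  shows "consequences P D \<subseteq> stage P D s"
proof
  fix F assume "F \<in> consequences P D"
  then show "F \<in> stage P D s"
  proof induction
    case (base F)
    then show ?case using stage_mono_index[of 0 s P D] by auto
  next
    case (step r \<sigma>)
    then have "ground \<sigma> (head r) \<in> stage P D (Suc s)" by (blast intro: stage_SucI)
    with assms show ?case by blast
  qed
qed

text \<open>The sum of the pointwise bounds dominates each of them. This is the source of every
  common number of rounds and every common size bound below.\<close>

lemma uniform_bound:
  fixes R :: "'a \<Rightarrow> nat \<Rightarrow> bool"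
  assumes "finite S" and "\<And>x. x \<in> S \<Longrightarrow> \<exists>m. R x m" and "\<And>x m n. R x m \<Longrightarrow> m \<le> n \<Longrightarrow> R x n"
  shows "\<exists>m. \<forall>x\<in>S. R x m"
proof -
  obtain f where f: "\<And>x. x \<in> S \<Longrightarrow> R x (f x)"
    using assms(2) by metis
  have "R x (\<Sum>y\<in>S. f y)" if "x \<in> S" for x
    using assms(3)[OF f[OF that]] member_le_sum[OF that, of f] assms(1) by simp
  then show ?thesis by blast
qed

lemma consequences_in_stage: "F \<in> consequences P D \<Longrightarrow> \<exists>s. F \<in> stage P D s"
proof (induction rule: consequences.induct)
  case (base F)
  then have "F \<in> stage P D 0" by simp
  then show ?case by blast
next
  case (step r \<sigma>)
  have "\<exists>s. \<forall>a\<in>set (body r). ground \<sigma> a \<in> stage P D s"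
  proof (rule uniform_bound)
    show "\<exists>s. ground \<sigma> a \<in> stage P D s" if "a \<in> set (body r)" for a
      using step(3)[OF that] .
  next
    fix a s t
    assume "ground \<sigma> a \<in> stage P D s" "s \<le> t"
    then show "ground \<sigma> a \<in> stage P D t" using stage_mono_index by blast
  qed simp
  then obtain s where "\<forall>a\<in>set (body r). ground \<sigma> a \<in> stage P D s" ..
  with step(1) have "ground \<sigma> (head r) \<in> stage P D (Suc s)" by (blast intro: stage_SucI)
  then show ?case by blast
qed

text \<open>A single number bounds body lengths, arities, variables and constants, so that the code of a
  program can serve as the bound.\<close>

definition bounded_by :: "nat \<Rightarrow> program \<Rightarrow> bool" where
  "bounded_by N P \<longleftrightarrow> (\<forall>r\<in>P. length (body r) \<le> N \<and>
     (\<forall>a\<in>insert (head r) (set (body r)). length (args a) \<le> N \<and>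
        (\<forall>t\<in>set (args a). (case t of Var x \<Rightarrow> x | Const c \<Rightarrow> c) < N)))"

lemma bounded_byD:
  assumes "bounded_by N P" "r \<in> P"
  shows "length (body r) \<le> N"
    and "a = head r \<or> a \<in> set (body r) \<Longrightarrow> length (args a) \<le> N"
    and "a = head r \<or> a \<in> set (body r) \<Longrightarrow> Var x \<in> set (args a) \<Longrightarrow> x < N"
    and "a = head r \<or> a \<in> set (body r) \<Longrightarrow> Const c \<in> set (args a) \<Longrightarrow> c < N"
  using assms unfolding bounded_by_def by (auto 0 3 split: tm.splits)

lemma bounded_by_mono: "bounded_by N P \<Longrightarrow> N \<le> N' \<Longrightarrow> bounded_by N' P"
  unfolding bounded_by_def by (meson order.trans order_less_le_trans)

section \<open>Derivations under renaming of constants\<close>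

lemma fmap_ground:
  assumes "\<And>c. Const c \<in> set (args a) \<Longrightarrow> h c = c"
  shows "fmap h (ground \<sigma> a) = ground (h \<circ> \<sigma>) a"
proof -
  have "h (tm_val \<sigma> t) = tm_val (h \<circ> \<sigma>) t" if "t \<in> set (args a)" for t
    using assms by (cases t) (use that in auto)
  then show ?thesis by (simp add: fmap_def ground_def)
qed

text \<open>Each rule application with \<open>\<sigma>\<close> is replayed with
  \<open>h \<circ> \<sigma>\<close>. Since bodies are positive, \<open>h\<close> may identify
  constants.\<close>

lemma stage_fmap:
  assumes "bounded_by N P" "\<And>c. c < N \<Longrightarrow> h c = c"
  shows "F \<in> stage P D s \<Longrightarrow> fmap h F \<in> stage P (fmap h ` D) s"
proof (induction s arbitrary: F)
  case (Suc s)
  show ?case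
  proof (cases "F \<in> D")
    case False
    from stage_SucE[OF Suc.prems False] obtain r \<sigma> where r: "r \<in> P" "F = ground \<sigma> (head r)"
      and b: "\<And>a. a \<in> set (body r) \<Longrightarrow> ground \<sigma> a \<in> stage P D s" by metis
    have g: "fmap h (ground \<sigma> a) = ground (h \<circ> \<sigma>) a" if "a = head r \<or> a \<in> set (body r)" for a
      by (rule fmap_ground) (use bounded_byD(4)[OF assms(1) r(1) that] assms(2) in blast)
    have "ground (h \<circ> \<sigma>) a \<in> stage P (fmap h ` D) s" if "a \<in> set (body r)" for a
      using Suc.IH[OF b[OF that]] g that by simp
    then show ?thesis using stage_SucI[OF r(1)] r(2) g by simp
  qed simp
qed simp

section \<open>Small supports and canonical copies of derivations\<close>

text \<open>A derivation uses a fact of the instance only by matching it with a body atom. Supports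
  therefore lie in this set, which for a finite program has finitely many symbols, although the
  instance may contain others.\<close>

definition body_instances :: "program \<Rightarrow> fact set" where
  "body_instances P = {ground \<sigma> a | \<sigma> r a. r \<in> P \<and> a \<in> set (body r)}"

definition facts_over :: "nat \<Rightarrow> fact set" where
  "facts_over M = {F. set (snd F) \<subseteq> {..<M}}"

text \<open>A derivation tree of depth \<open>s\<close> with at most \<open>N\<close> children per
  node has at most \<open>N ^ s\<close> leaves. The case \<open>F \<in> D\<close> stands apart
  because a fact of the instance need not match any body atom and can have any arity.\<close>

lemma small_support:
  assumes P: "bounded_by N P" "N > 0"
  shows "F \<in> stage P D s \<Longrightarrow> F \<in> D \<or> length (snd F) \<le> N \<and>
    (\<exists>E \<subseteq> D \<inter> body_instances P. finite E \<and> card E \<le> N ^ s \<and> F \<in> stage P E s)"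
proof (induction s arbitrary: F)
  case (Suc s)
  show ?case
  proof (cases "F \<in> D")
    case False
    from stage_SucE[OF Suc.prems False] obtain r \<sigma> where r: "r \<in> P" "F = ground \<sigma> (head r)"
      and b: "\<And>a. a \<in> set (body r) \<Longrightarrow> ground \<sigma> a \<in> stage P D s" by metis
    have "\<exists>E \<subseteq> D \<inter> body_instances P. finite E \<and> card E \<le> N ^ s \<and> ground \<sigma> a \<in> stage P E s"
      if a: "a \<in> set (body r)" for a
    proof (cases "ground \<sigma> a \<in> D")
      case True
      have "ground \<sigma> a \<in> body_instances P" using a r(1) unfolding body_instances_def by blast
      moreover have "ground \<sigma> a \<in> stage P {ground \<sigma> a} s"
        using stage_mono_index[of 0 s P "{ground \<sigma> a}"] by auto
      \<comment> \<open>A leaf above the full depth still counts as one fact; \<open>N > 0\<close>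
        gives \<open>1 \<le> N ^ s\<close>.\<close>
      ultimately show ?thesis using True P(2) by (intro exI[of _ "{ground \<sigma> a}"]) auto
    next
      case False
      then show ?thesis using Suc.IH a b by blast
    qed
    then obtain E where E: "\<And>a. a \<in> set (body r) \<Longrightarrow> E a \<subseteq> D \<inter> body_instances P \<and>
        finite (E a) \<and> card (E a) \<le> N ^ s \<and> ground \<sigma> a \<in> stage P (E a) s"
      by metis
    let ?E = "\<Union>a\<in>set (body r). E a"
    have "card ?E \<le> (\<Sum>a\<in>set (body r). card (E a))" by (rule card_UN_le) simp
    also have "\<dots> \<le> card (set (body r)) * N ^ s" using sum_bounded_above[of _ "\<lambda>a. card (E a)"] E by simp
    also have "\<dots> \<le> N * N ^ s"
      using bounded_byD(1)[OF P(1) r(1)] card_length[of "body r"] by (intro mult_right_mono) auto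
    finally have card: "card ?E \<le> N ^ Suc s" by simp
    have "ground \<sigma> a \<in> stage P ?E s" if "a \<in> set (body r)" for a
      using E[OF that] stage_mono_db[of "E a" ?E P s] that by blast
    then have "F \<in> stage P ?E (Suc s)" unfolding r(2) by (intro stage_SucI[OF r(1)])
    moreover have "length (snd F) \<le> N"
      using bounded_byD(2)[OF P(1) r(1)] r(2) by (simp add: ground_def)
    moreover have "?E \<subseteq> D \<inter> body_instances P" "finite ?E" using E by auto
    ultimately show ?thesis using card by blast
  qed simp
qed simp

text \<open>Constants below \<open>N\<close> stay in place, and the rest of \<open>K\<close> is sent
  injectively into \<open>{N..<M}\<close>, which has room for it; the two ranges are
  disjoint.\<close>

lemma inj_into_initial_segment:
  fixes K :: "nat set"
  assumes "finite K" "N + card K \<le> M"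
  shows "\<exists>\<rho>. inj_on \<rho> (K \<union> {..<N}) \<and> (\<forall>c<N. \<rho> c = c) \<and> \<rho> ` (K \<union> {..<N}) \<subseteq> {..<M}"
proof -
  have "card (K - {..<N}) \<le> card {N..<M}"
    using card_mono[OF assms(1), of "K - {..<N}"] assms(2) by auto
  then obtain f where f: "f ` (K - {..<N}) \<subseteq> {N..<M}" "inj_on f (K - {..<N})"
    using card_le_inj[of "K - {..<N}" "{N..<M}"] assms(1) by auto
  let ?\<rho> = "\<lambda>c. if c < N then c else f c"
  have range: "f c \<ge> N \<and> f c < M" if "c \<in> K" "\<not> c < N" for c
    using f(1) that by force
  have "inj_on ?\<rho> (K \<union> {..<N})"
  proof (rule inj_onI)
    fix x y assume xy: "x \<in> K \<union> {..<N}" "y \<in> K \<union> {..<N}" "?\<rho> x = ?\<rho> y"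
    show "x = y"
    proof (cases "x < N"; cases "y < N")
      assume "\<not> x < N" "\<not> y < N"
      with xy show "x = y" by (simp add: inj_on_eq_iff[OF f(2)])
    qed (use xy range[of x] range[of y] in simp_all)
  qed
  with range show ?thesis using assms(2) by (intro exI[of _ ?\<rho>]) auto
qed

text \<open>The first \<open>N\<close> numbers are reserved for the constants of the program. A
  derived fact and its at most \<open>N ^ s\<close> supporting facts have at most \<open>N\<close>
  entries each, which accounts for the second summand.\<close>

definition width :: "nat \<Rightarrow> nat \<Rightarrow> nat" where
  "width N s = N + N * Suc (N ^ s)"

text \<open>The constants of the fact and of a small support are renamed into the initial segment,
  and \<open>h\<close> undoes the renaming. For a finite program only finitely many pairs
  \<open>(E, G)\<close> can arise, whatever \<open>D\<close> is.\<close>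

lemma canonical_derivation:
  assumes P: "bounded_by N P" "N > 0" and F: "F \<in> stage P D s" "F \<notin> D"
  obtains E G h where "finite E" "E \<subseteq> body_instances P" "insert G E \<subseteq> facts_over (width N s)"
    "G \<in> stage P E s" "\<And>c. c < N \<Longrightarrow> h c = c" "fmap h ` E \<subseteq> D" "fmap h G = F"
proof -
  obtain D' where D': "D' \<subseteq> D" "D' \<subseteq> body_instances P" "finite D'" "card D' \<le> N ^ s" "F \<in> stage P D' s"
    and len: "length (snd F) \<le> N"
    using small_support[OF P F(1)] F(2) by auto
  define K where "K = (\<Union>G\<in>insert F D'. set (snd G))"
  have "length (snd G) \<le> N" if "G \<in> insert F D'" for G
    using that D'(2) len bounded_byD(2)[OF P(1)] by (auto simp: body_instances_def ground_def)
  then have "card (set (snd G)) \<le> N" if "G \<in> insert F D'" for G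
    using that card_length order.trans by blast
  then have "(\<Sum>G\<in>insert F D'. card (set (snd G))) \<le> card (insert F D') * N"
    using sum_bounded_above[of "insert F D'" "\<lambda>G. card (set (snd G))" N] by simp
  moreover have "card K \<le> (\<Sum>G\<in>insert F D'. card (set (snd G)))"
    unfolding K_def by (rule card_UN_le) (use D' in simp)
  moreover have "card (insert F D') \<le> Suc (N ^ s)"
    using D'(3,4) by (simp add: card_insert_if)
  then have "card (insert F D') * N \<le> Suc (N ^ s) * N" by (rule mult_right_mono) simp
  ultimately have "N + card K \<le> width N s" by (simp add: width_def algebra_simps)
  moreover have "finite K" using D'(3) by (simp add: K_def)
  ultimately obtain \<rho> where \<rho>: "inj_on \<rho> (K \<union> {..<N})" "\<And>c. c < N \<Longrightarrow> \<rho> c = c"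
      "\<rho> ` (K \<union> {..<N}) \<subseteq> {..<width N s}"
    using inj_into_initial_segment by metis
  \<comment> \<open>The inverse is taken on a set that includes \<open>{..<N}\<close>, so it fixes
    the constants of the program as \<open>\<rho>\<close> does.\<close>
  let ?h = "inv_into (K \<union> {..<N}) \<rho>"
  have h: "?h (\<rho> c) = c" if "c \<in> K \<union> {..<N}" for c
    using inv_into_f_f[OF \<rho>(1) that] .
  have inverse: "fmap ?h (fmap \<rho> G) = G" if "G \<in> insert F D'" for G
    unfolding fmap_fmap by (rule fmap_idI) (use h that in \<open>auto simp: K_def\<close>)
  show thesis
  proof
    show "finite (fmap \<rho> ` D')" using D'(3) by simp
    show "fmap \<rho> ` D' \<subseteq> body_instances P"
    proof
      fix G assume "G \<in> fmap \<rho> ` D'"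
      then obtain \<sigma> r a where r: "r \<in> P" "a \<in> set (body r)" "G = fmap \<rho> (ground \<sigma> a)"
        using D'(2) unfolding body_instances_def by blast
      have "G = ground (\<rho> \<circ> \<sigma>) a"
        unfolding r(3) by (rule fmap_ground) (use bounded_byD(4)[OF P(1) r(1)] r(2) \<rho>(2) in blast)
      then show "G \<in> body_instances P" using r unfolding body_instances_def by blast
    qed
    show "insert (fmap \<rho> F) (fmap \<rho> ` D') \<subseteq> facts_over (width N s)"
    proof -
      have "fmap \<rho> G \<in> facts_over (width N s)" if "G \<in> insert F D'" for G
        using that \<rho>(3) unfolding facts_over_def K_def by fastforce
      then show ?thesis by auto
    qed
    show "fmap \<rho> F \<in> stage P (fmap \<rho> ` D') s" by (rule stage_fmap[OF P(1) \<rho>(2) D'(5)])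
    show "?h c = c" if "c < N" for c using h[of c] \<rho>(2)[OF that] that by simp
    show "fmap ?h ` fmap \<rho> ` D' \<subseteq> D" using inverse D'(1) by auto
    show "fmap ?h (fmap \<rho> F) = F" using inverse by simp
  qed
qed

lemma edb_instance_fmap_iff: "finite D \<Longrightarrow> edb_instance P (fmap h ` D) \<longleftrightarrow> edb_instance P D"
  by (simp add: edb_instance_def)

lemma edb_instance_subset: "edb_instance P D \<Longrightarrow> E \<subseteq> D \<Longrightarrow> edb_instance P E"
  unfolding edb_instance_def using finite_subset by blast

lemma canonical_edb_instance:
  "finite E \<Longrightarrow> fmap h ` E \<subseteq> D \<Longrightarrow> edb_instance P D \<Longrightarrow> edb_instance P E"
  using edb_instance_subset[of P D "fmap h ` E"] by (simp add: edb_instance_fmap_iff)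

definition stabilizes_at :: "program \<Rightarrow> nat \<Rightarrow> bool" where
  "stabilizes_at P k \<longleftrightarrow> (\<forall>D. edb_instance P D \<longrightarrow> stage P D (Suc k) \<subseteq> stage P D k)"

lemma stage_transfer:
  assumes "bounded_by N P" "\<And>c. c < N \<Longrightarrow> h c = c" "G \<in> stage P E k" "fmap h ` E \<subseteq> D"
  shows "fmap h G \<in> stage P D k"
  using stage_fmap[OF assms(1,2,3)] stage_mono_db[OF assms(4)] by blast

text \<open>A fact of round \<open>Suc k\<close> over any \<open>D\<close> has a canonical copy
  \<open>G\<close> over some \<open>E\<close>; once \<open>G\<close> appears by round
  \<open>k\<close>, \<open>h\<close> carries that shorter derivation back to \<open>D\<close>. The
  width is that of \<open>Suc k\<close> because a derivation with \<open>Suc k\<close> rounds is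
  copied.\<close>

lemma stabilizes_at_iff_canonical:
  assumes P: "bounded_by N P" "N > 0"
    and M: "M = width N (Suc k)"
  shows "stabilizes_at P k \<longleftrightarrow>
    (\<forall>E. edb_instance P E \<and> E \<subseteq> body_instances P \<inter> facts_over M \<longrightarrow>
       stage P E (Suc k) \<inter> facts_over M \<subseteq> stage P E k)"
    (is "_ \<longleftrightarrow> ?R")
proof
  assume R: ?R
  have "F \<in> stage P D k" if D: "edb_instance P D" and F: "F \<in> stage P D (Suc k)" for D F
  proof (cases "F \<in> D")
    case True
    then show ?thesis using stage_mono_index[of 0 k P D] by auto
  next
    case False
    from canonical_derivation[OF P F False] obtain E G h where
      E: "finite E" "E \<subseteq> body_instances P" "insert G E \<subseteq> facts_over M" "G \<in> stage P E (Suc k)"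
      and h: "\<And>c. c < N \<Longrightarrow> h c = c" "fmap h ` E \<subseteq> D" "fmap h G = F"
      unfolding M by metis
    have "G \<in> stage P E k"
      using R E canonical_edb_instance[OF E(1) h(2) D] by blast
    then show ?thesis using stage_transfer[OF P(1) h(1) _ h(2)] h(3) by metis
  qed
  then show "stabilizes_at P k" unfolding stabilizes_at_def by blast
next
  assume "stabilizes_at P k"
  then show ?R unfolding stabilizes_at_def by (meson inf.coboundedI1)
qed

section \<open>Boundedness as stabilization\<close>

lemma finite_bounded_facts:
  assumes "finite S"
  shows "finite {F \<in> facts_over M. fact_sym F \<in> S}"
proof (rule finite_subset)
  show "{F \<in> facts_over M. fact_sym F \<in> S} \<subseteq>
      (\<Union>q\<in>S. {fst q} \<times> {xs. set xs \<subseteq> {..<M} \<and> length xs = snd q})"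
    by (force simp: facts_over_def fact_sym_def)
  show "finite (\<Union>q\<in>S. {fst q} \<times> {xs. set xs \<subseteq> {..<M} \<and> length xs = snd q})"
    using assms finite_lists_length_eq by blast
qed

lemma finite_idb: "finite P \<Longrightarrow> finite (idb P)"
  unfolding idb_def by (rule finite_subset[of _ "(\<lambda>r. atom_sym (head r)) ` P"]) auto

lemma finite_body_instances:
  assumes "finite P"
  shows "finite (body_instances P \<inter> facts_over M)"
proof -
  have "finite (\<Union>r\<in>P. atom_sym ` set (body r))" using assms by simp
  from finite_bounded_facts[OF this, of M] show ?thesis
    by (rule rev_finite_subset) (fastforce simp: body_instances_def)
qed

lemma ex_bounded_by:
  assumes "finite P"
  shows "\<exists>N. bounded_by N P"
proof -
  have "\<exists>N. bounded_by N {r}" for r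
  proof -
    have "\<exists>N. \<forall>a\<in>insert (head r) (set (body r)). length (args a) \<le> N \<and>
        (\<forall>t\<in>set (args a). (case t of Var x \<Rightarrow> x | Const c \<Rightarrow> c) < N)"
    proof (rule uniform_bound)
      fix a
      have "\<exists>N. \<forall>t\<in>set (args a). (case t of Var x \<Rightarrow> x | Const c \<Rightarrow> c) < N"
        by (rule uniform_bound) auto
      then obtain N where "\<forall>t\<in>set (args a). (case t of Var x \<Rightarrow> x | Const c \<Rightarrow> c) < N" ..
      then show "\<exists>N. length (args a) \<le> N \<and>
          (\<forall>t\<in>set (args a). (case t of Var x \<Rightarrow> x | Const c \<Rightarrow> c) < N)"
        by (intro exI[of _ "N + length (args a)"]) fastforce
    qed fastforce+
    then obtain N where "\<forall>a\<in>insert (head r) (set (body r)). length (args a) \<le> N \<and>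
        (\<forall>t\<in>set (args a). (case t of Var x \<Rightarrow> x | Const c \<Rightarrow> c) < N)" ..
    then show ?thesis
      unfolding bounded_by_def by (intro exI[of _ "N + length (body r)"]) fastforce
  qed
  then have "\<exists>N. \<forall>r\<in>P. bounded_by N {r}"
    by (intro uniform_bound[OF assms]) (blast intro: bounded_by_mono)+
  then show ?thesis unfolding bounded_by_def by simp
qed

text \<open>Well-founded induction along the dependencies: a predicate needs one round more than the
  predicates in the bodies of its rules. Finiteness of the dependency relation turns acyclicity into
  well-foundedness.\<close>

lemma nonrecursive_stage_bound:
  assumes Q: "finite Q" "nonrecursive Q"
  shows "\<exists>m. \<forall>D. consequences Q D \<subseteq> stage Q D m"
proof -
  define R where
    "R q m \<longleftrightarrow> (\<forall>D F. F \<in> consequences Q D \<longrightarrow> fact_sym F = q \<longrightarrow> F \<in> stage Q D m)" for q m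
  have RD: "F \<in> stage Q D m" if "R (fact_sym F) m" "F \<in> consequences Q D" for F D m
    using that(1)[unfolded R_def, rule_format, OF that(2) refl] .
  have R_mono: "R q n" if "R q m" "m \<le> n" for q m n
    unfolding R_def
  proof (intro allI impI)
    fix D F assume "F \<in> consequences Q D" "fact_sym F = q"
    with that(1) have "F \<in> stage Q D m" using RD by blast
    then show "F \<in> stage Q D n" by (rule subsetD[OF stage_mono_index[OF that(2)]])
  qed
  have "dependency Q = (\<Union>r\<in>Q. (\<lambda>a. (atom_sym (head r), atom_sym a)) ` set (body r))"
    by (auto simp: dependency_def)
  then have fin: "finite (dependency Q)" using Q(1) by simp
  then have "wf ((dependency Q)\<inverse>)"
    using Q(2) by (simp add: nonrecursive_def finite_acyclic_wf_converse)
  then have R_ex: "\<exists>m. R q m" for q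
  proof (induction q rule: wf_induct_rule)
    case (less q)
    have "\<exists>m. \<forall>q'\<in>dependency Q `` {q}. R q' m"
    proof (rule uniform_bound)
      show "finite (dependency Q `` {q})" using fin by (rule finite_Image)
    next
      fix q' assume "q' \<in> dependency Q `` {q}"
      then show "\<exists>m. R q' m" by (intro less) simp
    qed (rule R_mono)
    then obtain m where m: "\<And>q'. (q, q') \<in> dependency Q \<Longrightarrow> R q' m" by auto
    have "F \<in> stage Q D (Suc m)" if "F \<in> consequences Q D" "fact_sym F = q" for D F
      using that(1)
    proof cases
      case (step r \<sigma>)
      have "ground \<sigma> a \<in> stage Q D m" if a: "a \<in> set (body r)" for a
      proof (rule RD)
        have "q = atom_sym (head r)" using \<open>fact_sym F = q\<close> step(1) by simp
        then have "(q, atom_sym a) \<in> dependency Q"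
          using step(2) a by (auto simp: dependency_def)
        then show "R (fact_sym (ground \<sigma> a)) m" using m by simp
      qed (rule step(3)[OF a])
      then show ?thesis unfolding step(1) by (intro stage_SucI[OF step(2)])
    qed simp
    then show ?case unfolding R_def by meson
  qed
  \<comment> \<open>Infinitely many symbols exist, but only those of rule heads need a common bound:
    a fact with any other symbol can only come from \<open>D\<close>.\<close>
  have "\<exists>m. \<forall>q\<in>(\<lambda>r. atom_sym (head r)) ` Q. R q m"
    by (rule uniform_bound) (use Q(1) R_ex R_mono in auto)
  then obtain m where m: "\<And>r. r \<in> Q \<Longrightarrow> R (atom_sym (head r)) m" by auto
  have "F \<in> stage Q D m" if F: "F \<in> consequences Q D" for D F
    using F
  proof cases
    case base
    then show ?thesis using subsetD[OF stage_mono_index[of 0 m Q D]] by simp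
  next
    case (step r \<sigma>)
    then show ?thesis using RD[OF _ F] m[of r] by simp
  qed
  then show ?thesis by blast
qed

lemma computed_relation_eq_iff:
  "(\<forall>q\<in>S. computed_relation P D q = computed_relation Q D q) \<longleftrightarrow>
   (\<forall>F. fact_sym F \<in> S \<longrightarrow> F \<in> consequences P D \<longleftrightarrow> F \<in> consequences Q D)"
  (is "?L \<longleftrightarrow> ?R")
proof (rule iffI; intro allI ballI impI)
  fix F assume "?L" "fact_sym F \<in> S"
  then have "computed_relation P D (fact_sym F) = computed_relation Q D (fact_sym F)" ..
  then have "snd F \<in> computed_relation P D (fact_sym F) \<longleftrightarrow> snd F \<in> computed_relation Q D (fact_sym F)"
    by simp
  then show "F \<in> consequences P D \<longleftrightarrow> F \<in> consequences Q D"
    by (simp add: computed_relation_def fact_sym_def)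
next
  fix q assume R: ?R and "q \<in> S"
  show "computed_relation P D q = computed_relation Q D q"
    unfolding computed_relation_def
  proof (rule Collect_cong, rule rev_conj_cong[OF refl])
    fix cs :: "nat list" assume "length cs = snd q"
    with \<open>q \<in> S\<close> have "fact_sym (fst q, cs) \<in> S" by (simp add: fact_sym_def)
    then show "(fst q, cs) \<in> consequences P D \<longleftrightarrow> (fst q, cs) \<in> consequences Q D"
      by (rule R[rule_format])
  qed
qed

text \<open>\<open>Q\<close> supplies the small support, \<open>P\<close> the number of rounds. A
  fact derived by \<open>P\<close> is derived by \<open>Q\<close> within \<open>m\<close> rounds,
  hence has a canonical copy \<open>(E, G)\<close> with respect to \<open>Q\<close>. By equivalence
  \<open>P\<close> also derives \<open>G\<close> from \<open>E\<close>; the finitely many pairs have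
  a common \<open>k\<close>, and \<open>h\<close> transfers the derivation by \<open>P\<close> back
  to \<open>D\<close>.\<close>

lemma bounded_imp_stabilizes:
  assumes P: "finite P" and "bounded_program P"
  shows "\<exists>k. stabilizes_at P k"
proof -
  obtain Q where Q: "finite Q" "nonrecursive Q" and eq: "equivalent_to P Q"
    using assms(2) unfolding bounded_program_def datalog_program_def by blast
  have PQ: "F \<in> consequences P D \<longleftrightarrow> F \<in> consequences Q D"
    if "edb_instance P D" "fact_sym F \<in> idb P" for D F
  proof -
    have "\<forall>q\<in>idb P. computed_relation P D q = computed_relation Q D q"
      using eq that(1) unfolding equivalent_to_def by blast
    then show ?thesis unfolding computed_relation_eq_iff using that(2) by blast
  qed
  obtain m where m: "\<And>D. consequences Q D \<subseteq> stage Q D m"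
    using nonrecursive_stage_bound[OF Q] by blast
  obtain N1 N2 where "bounded_by N1 P" "bounded_by N2 Q"
    using ex_bounded_by P Q(1) by meson
  \<comment> \<open>One bound for both programs: the copy is made from a derivation of
    \<open>Q\<close>, while the transfer back concerns \<open>P\<close>, so \<open>h\<close> has to
    fix the constants of both.\<close>
  define N where "N = Suc (N1 + N2)"
  have N: "bounded_by N P" "bounded_by N Q" "N > 0"
    using bounded_by_mono \<open>bounded_by N1 P\<close> \<open>bounded_by N2 Q\<close> by (auto simp: N_def)
  let ?M = "width N m"
  let ?B = "body_instances Q \<inter> facts_over ?M" and ?H = "{F \<in> facts_over ?M. fact_sym F \<in> idb P}"
  have "\<exists>k. \<forall>(E, G)\<in>Pow ?B \<times> ?H. G \<in> consequences P E \<longrightarrow> G \<in> stage P E k"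
  proof (rule uniform_bound)
    show "finite (Pow ?B \<times> ?H)"
      using finite_body_instances[OF Q(1), of ?M] finite_bounded_facts[OF finite_idb[OF P], of ?M]
      by (intro finite_cartesian_product) (simp_all only: finite_Pow_iff)
  next
    fix x
    show "\<exists>k. case x of (E, G) \<Rightarrow> G \<in> consequences P E \<longrightarrow> G \<in> stage P E k"
      using consequences_in_stage by (cases x) auto
  next
    fix x k l
    assume "case x of (E, G) \<Rightarrow> G \<in> consequences P E \<longrightarrow> G \<in> stage P E k" "k \<le> l"
    then show "case x of (E, G) \<Rightarrow> G \<in> consequences P E \<longrightarrow> G \<in> stage P E l"
      using stage_mono_index[of k l] by auto
  qed
  then obtain k where
    k_all: "\<forall>(E, G)\<in>Pow ?B \<times> ?H. G \<in> consequences P E \<longrightarrow> G \<in> stage P E k" ..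
  have k: "G \<in> stage P E k" if "E \<subseteq> ?B" "G \<in> ?H" "G \<in> consequences P E" for E G
    using bspec[OF k_all, of "(E, G)"] that by simp
  have idb_case: "F \<in> stage P D k"
    if D: "edb_instance P D" and F: "F \<in> consequences P D" "fact_sym F \<in> idb P" for D F
  proof -
    have FQ: "F \<in> stage Q D m" using PQ[OF D F(2)] F(1) subsetD[OF m] by simp
    have "F \<notin> D" using D F(2) unfolding edb_instance_def by blast
    from canonical_derivation[OF N(2,3) FQ this] obtain E G h where
      E: "finite E" "E \<subseteq> body_instances Q" "insert G E \<subseteq> facts_over ?M" "G \<in> stage Q E m"
      and h: "\<And>c. c < N \<Longrightarrow> h c = c" "fmap h ` E \<subseteq> D" "fmap h G = F"
      by metis
    have sym: "fact_sym G \<in> idb P" using h(3) F(2) by auto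
    have "G \<in> consequences P E"
      using PQ[OF canonical_edb_instance[OF E(1) h(2) D] sym] subsetD[OF stage_subset_consequences E(4)]
      by simp
    then have "G \<in> stage P E k" using E sym by (intro k) auto
    from stage_transfer[OF N(1) h(1) this h(2)] h(3) show ?thesis by simp
  qed
  \<comment> \<open>Equivalence says nothing about symbols outside \<open>idb P\<close>. Such a fact
    outside \<open>D\<close> comes from a rule with empty body and is present after one round, hence
    \<open>Suc k\<close> instead of \<open>k\<close>.\<close>
  have "F \<in> stage P D (Suc k)" if D: "edb_instance P D" and F: "F \<in> stage P D (Suc (Suc k))" for D F
  proof (cases "fact_sym F \<in> idb P")
    case True
    have "F \<in> consequences P D" by (rule subsetD[OF stage_subset_consequences F])
    from idb_case[OF D this True] show ?thesis by (rule subsetD[OF stage_Suc_subset])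
  next
    case False
    show ?thesis
    proof (cases "F \<in> D")
      case False
      with F obtain r \<sigma> where r: "r \<in> P" "F = ground \<sigma> (head r)" by (blast elim: stage_SucE)
      with \<open>fact_sym F \<notin> idb P\<close> have "body r = []" unfolding idb_def by auto
      with r show ?thesis using stage_SucI[OF r(1), of \<sigma>] by simp
    qed simp
  qed
  then have "stabilizes_at P (Suc k)" unfolding stabilizes_at_def by blast
  then show ?thesis ..
qed

section \<open>Reading off a non-recursive program\<close>

text \<open>The usual passage from a canonical database to a conjunctive query: numbers reserved for
  the program stay constants, and every other number becomes the variable with the same
  index.\<close>

definition lift_fact :: "nat \<Rightarrow> fact \<Rightarrow> atom" where
  "lift_fact N F = Atom (fst F) (map (\<lambda>c. if c < N then Const c else Var c) (snd F))"

lemma ground_lift_fact: "ground \<sigma> (lift_fact N F) = fmap (\<lambda>c. if c < N then c else \<sigma> c) F"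
  by (simp add: ground_def lift_fact_def fmap_def)

lemma atom_sym_lift_fact [simp]: "atom_sym (lift_fact N F) = fact_sym F"
  by (simp add: atom_sym_def lift_fact_def fact_sym_def)

text \<open>Each canonical pair becomes one rule of \<open>Q\<close>. Completeness instantiates it
  with the renaming \<open>h\<close>; for soundness any instantiation of the rule is itself a
  renaming that fixes the program constants, so the derivation behind the pair is carried
  along.\<close>

lemma stabilizes_imp_bounded:
  assumes P: "finite P" and stab: "stabilizes_at P k"
  shows "bounded_program P"
proof -
  obtain N0 where "bounded_by N0 P" using ex_bounded_by[OF P] ..
  then obtain N where N: "bounded_by N P" "N > 0"
    using bounded_by_mono[of N0 P "Suc N0"] by auto
  let ?M = "width N k"
  define B where "B = {G \<in> body_instances P \<inter> facts_over ?M. fact_sym G \<notin> idb P}"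
  define H where "H = {F \<in> facts_over ?M. fact_sym F \<in> idb P}"
  \<comment> \<open>Bodies are lists, and \<open>distinct\<close> keeps their number finite.\<close>
  define Q where "Q = {Rule (lift_fact N G) (map (lift_fact N) Es) | G Es.
    G \<in> H \<and> set Es \<subseteq> B \<and> distinct Es \<and> G \<in> stage P (set Es) k}"
  have "finite B"
    using finite_body_instances[OF P, of ?M] unfolding B_def by (rule rev_finite_subset) blast
  moreover have "finite H"
    using finite_bounded_facts[OF finite_idb[OF P]] unfolding H_def .
  ultimately have "finite (H \<times> {Es. set Es \<subseteq> B \<and> distinct Es})"
    by (intro finite_cartesian_product finite_subset_distinct)
  then have finQ: "finite Q"
    by (rule finite_surj[where f = "\<lambda>(G, Es). Rule (lift_fact N G) (map (lift_fact N) Es)"])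
      (auto simp: Q_def)
  have head: "atom_sym (head r) \<in> idb P" if "r \<in> Q" for r
    using that unfolding Q_def H_def by auto
  have body: "atom_sym a \<notin> idb P" if "r \<in> Q" "a \<in> set (body r)" for r a
  proof -
    from that obtain E where "E \<in> B" "a = lift_fact N E" unfolding Q_def by fastforce
    then show ?thesis unfolding B_def by simp
  qed
  \<comment> \<open>Edges lead from IDB to non-IDB symbols, so no two of them compose and the
    relation is vacuously transitive.\<close>
  have "dependency Q \<subseteq> idb P \<times> - idb P"
    using head body unfolding dependency_def by blast
  then have "trans (dependency Q)" "irrefl (dependency Q)"
    unfolding trans_def irrefl_def by blast+
  then have nonrec: "nonrecursive Q"
    unfolding nonrecursive_def by (simp add: acyclic_irrefl)
  have "F \<in> consequences P D \<longleftrightarrow> F \<in> consequences Q D"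
    if D: "edb_instance P D" and F: "fact_sym F \<in> idb P" for D F
  proof
    have "F \<notin> D" using D F unfolding edb_instance_def by blast
    assume "F \<in> consequences P D"
    then have "F \<in> stage P D k"
      using consequences_subset_stage stab D unfolding stabilizes_at_def by blast
    from canonical_derivation[OF N this \<open>F \<notin> D\<close>] obtain E G h where
      E: "finite E" "E \<subseteq> body_instances P" "insert G E \<subseteq> facts_over ?M" "G \<in> stage P E k"
      and h: "\<And>c. c < N \<Longrightarrow> h c = c" "fmap h ` E \<subseteq> D" "fmap h G = F"
      by metis
    have "(\<lambda>c. if c < N then c else h c) = h" using h(1) by auto
    then have ground: "ground h (lift_fact N G') = fmap h G'" for G'
      by (simp add: ground_lift_fact)
    obtain Es where Es: "set Es = E" "distinct Es" using finite_distinct_list[OF E(1)] by blast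
    have "edb_instance P E" using canonical_edb_instance[OF E(1) h(2) D] .
    then have "E \<subseteq> B" using E unfolding B_def edb_instance_def by blast
    moreover have "G \<in> H" using E F h(3) unfolding H_def by auto
    ultimately have r: "Rule (lift_fact N G) (map (lift_fact N) Es) \<in> Q"
      using E Es unfolding Q_def by blast
    have "ground h (head (Rule (lift_fact N G) (map (lift_fact N) Es))) \<in> consequences Q D"
    proof (rule consequences.step[OF r])
      fix a assume "a \<in> set (body (Rule (lift_fact N G) (map (lift_fact N) Es)))"
      then obtain E' where "E' \<in> E" "a = lift_fact N E'" using Es(1) by fastforce
      then have "ground h a \<in> D" using ground h(2) by blast
      then show "ground h a \<in> consequences Q D" by (rule consequences.base)
    qed
    then show "F \<in> consequences Q D" using ground h(3) by simp
  next
    \<comment> \<open>All heads of \<open>Q\<close> have symbols in \<open>idb P\<close>, so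
      consequences with other symbols must already lie in the instance.\<close>
    have edb: "G \<in> D" if "G \<in> consequences Q D" "fact_sym G \<notin> idb P" for G
      using that(1) by cases (use that(2) head in auto)
    assume "F \<in> consequences Q D"
    then show "F \<in> consequences P D"
    proof cases
      case (step r \<sigma>)
      from step(2) obtain G Es where r: "r = Rule (lift_fact N G) (map (lift_fact N) Es)"
        and G: "set Es \<subseteq> B" "G \<in> stage P (set Es) k" unfolding Q_def by blast
      let ?h = "\<lambda>c. if c < N then c else \<sigma> c"
      have "fmap ?h ` set Es \<subseteq> D"
      proof
        fix G' assume "G' \<in> fmap ?h ` set Es"
        then obtain E' where E': "E' \<in> set Es" "G' = ground \<sigma> (lift_fact N E')"
          by (auto simp: ground_lift_fact)
        then have "G' \<in> consequences Q D" using step(3)[of "lift_fact N E'"] r by simp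
        moreover have "fact_sym G' \<notin> idb P" using E' G(1) unfolding B_def by auto
        ultimately show "G' \<in> D" by (rule edb)
      qed
      then have "fmap ?h G \<in> stage P D k"
        by (intro stage_transfer[OF N(1) _ G(2)]) simp
      then show ?thesis
        using subsetD[OF stage_subset_consequences] step(1) r by (simp add: ground_lift_fact)
    qed (rule consequences.base)
  qed
  then have "\<forall>q\<in>idb P. computed_relation P D q = computed_relation Q D q"
    if "edb_instance P D" for D
    unfolding computed_relation_eq_iff using that by blast
  moreover have "idb Q \<subseteq> idb P" using head unfolding idb_def[of Q] by blast
  ultimately have "equivalent_to P Q" unfolding equivalent_to_def by blast
  then show ?thesis
    using finQ nonrec unfolding bounded_program_def datalog_program_def by blast
qed

lemma bounded_iff_stabilizes: "finite P \<Longrightarrow> bounded_program P \<longleftrightarrow> (\<exists>k. stabilizes_at P k)"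
  by (rule iffI) (rule bounded_imp_stabilizes, assumption+, erule exE, rule stabilizes_imp_bounded)

section \<open>Computable functions on coded types\<close>

text \<open>Since \<open>enc\<close> is a bijection, \<open>inv enc\<close> decodes every number, and it is computed by the
  identity on codes.\<close>

class enc =
  fixes enc :: "'a \<Rightarrow> nat"
  assumes bij_enc: "bij enc"
begin

lemma enc_eq_iff [simp]: "enc x = enc y \<longleftrightarrow> x = y"
  using bij_enc by (simp add: bij_is_inj inj_eq)

lemma enc_inv [simp]: "enc (inv enc n) = n"
  by (rule surj_f_inv_f[OF bij_is_surj[OF bij_enc]])

end

instantiation nat :: enc
begin
definition enc_nat :: "nat \<Rightarrow> nat" where [simp]: "enc_nat n = n"
instance by standard (simp add: enc_nat_def[abs_def] bij_def inj_def)
end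

lemma bij_prod_encode_map:
  assumes "bij f" "bij g"
  shows "bij (\<lambda>p. prod_encode (f (fst p), g (snd p)))"
  using bij_comp[OF bij_betw_map_prod[OF assms, unfolded UNIV_Times_UNIV] bij_prod_encode]
  by (simp add: comp_def map_prod_def split_beta)

lemma bij_list_encode_map:
  assumes "bij f"
  shows "bij (\<lambda>xs. list_encode (map f xs))"
proof (rule bijI)
  show "inj (\<lambda>xs. list_encode (map f xs))"
    using assms by (auto intro!: injI simp: list_encode_eq bij_is_inj inj_map_eq_map)
  show "surj (\<lambda>xs. list_encode (map f xs))"
    by (rule surjI[of _ "\<lambda>n. map (inv f) (list_decode n)"])
      (simp add: comp_def bij_is_surj[OF assms] surj_f_inv_f)
qed

instantiation prod :: (enc, enc) enc
begin
definition enc_prod :: "'a \<times> 'b \<Rightarrow> nat" where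
  "enc_prod p = prod_encode (enc (fst p), enc (snd p))"
instance by standard (simp add: enc_prod_def[abs_def] bij_prod_encode_map bij_enc)
end

instantiation list :: (enc) enc
begin
definition enc_list :: "'a list \<Rightarrow> nat" where
  "enc_list xs = list_encode (map enc xs)"
instance by standard (simp add: enc_list_def[abs_def] bij_list_encode_map bij_enc)
end

instantiation tm :: enc
begin
definition enc_tm :: "tm \<Rightarrow> nat" where "enc_tm = tm_code"
instance
proof
  have "surj tm_code"
  proof (rule surjI)
    fix n
    show "tm_code (case sum_decode n of Inl x \<Rightarrow> Var x | Inr c \<Rightarrow> Const c) = n"
      using sum_decode_inverse[of n] by (cases "sum_decode n") simp_all
  qed
  then show "bij (enc :: tm \<Rightarrow> nat)" by (simp add: enc_tm_def bij_def inj_tm_code)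
qed
end

instantiation atom :: enc
begin
definition enc_atom :: "atom \<Rightarrow> nat" where "enc_atom a = enc (aname a, args a)"
instance
proof
  have "bij (\<lambda>a. (aname a, args a))"
    by (rule o_bij[of "\<lambda>(p, ts). Atom p ts"]) auto
  from bij_comp[OF this bij_enc] show "bij (enc :: atom \<Rightarrow> nat)"
    by (simp add: enc_atom_def[abs_def] comp_def)
qed
end

instantiation rule :: enc
begin
definition enc_rule :: "rule \<Rightarrow> nat" where "enc_rule r = enc (head r, body r)"
instance
proof
  have "bij (\<lambda>r. (head r, body r))"
    by (rule o_bij[of "\<lambda>(a, as). Rule a as"]) auto
  from bij_comp[OF this bij_enc] show "bij (enc :: rule \<Rightarrow> nat)"
    by (simp add: enc_rule_def[abs_def] comp_def)
qed
end

text \<open>The class instances follow the given coding constructor by constructor, so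
  \<open>inv enc\<close> decodes the numbers in a program code.\<close>

lemma rule_code_eq_enc: "rule_code = enc"
  by (rule ext) (simp add: rule_code_def atom_code_def[abs_def] enc_rule_def enc_atom_def[abs_def]
      enc_prod_def enc_list_def enc_tm_def)

lemma enc_Nil [simp]: "enc [] = 0"
  and enc_Cons: "enc (x # xs) = Suc (prod_encode (enc x, enc xs))"
  by (simp_all add: enc_list_def)

section \<open>Arithmetic and pairing as recursive functions\<close>

lemma rec_eval_Proj: "i < length xs \<Longrightarrow> xs ! i = y \<Longrightarrow> rec_eval (Proj i) xs y"
  using rec_eval.Proj by blast

lemma rec_eval_Comp1: "rec_eval g xs a \<Longrightarrow> rec_eval f [a] z \<Longrightarrow> rec_eval (Comp f [g]) xs z"
  by (rule rec_eval.Comp[of _ _ "[a]"]) simp_all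

lemma rec_eval_Comp2:
  "rec_eval g xs a \<Longrightarrow> rec_eval h xs b \<Longrightarrow> rec_eval f [a, b] z \<Longrightarrow> rec_eval (Comp f [g, h]) xs z"
  by (rule rec_eval.Comp[of _ _ "[a, b]"]) simp_all

lemma rec_eval_PrimRec:
  assumes "rec_eval f xs (F 0)" "\<And>n. rec_eval g (n # F n # xs) (F (Suc n))"
  shows "rec_eval (PrimRec f g) (n # xs) (F n)"
proof (induction n)
  case 0
  show ?case by (rule rec_eval.PrimRec_0[OF assms(1)])
next
  case (Suc n)
  show ?case by (rule rec_eval.PrimRec_Suc[OF Suc assms(2)])
qed

definition r_add :: recf where "r_add = PrimRec (Proj 0) (Comp Succ [Proj 1])"

lemma rec_eval_add: "rec_eval r_add [m, n] (m + n)"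
  unfolding r_add_def
  by (rule rec_eval_PrimRec) (auto intro!: rec_eval_Proj rec_eval_Comp1 rec_eval.Succ)

definition r_pred :: recf where "r_pred = PrimRec Zero (Proj 0)"

lemma rec_eval_pred: "rec_eval r_pred [n] (n - 1)"
  unfolding r_pred_def
  by (rule rec_eval_PrimRec) (auto intro!: rec_eval_Proj rec_eval.Zero)

text \<open>Recursion acts on the first argument, so the subtrahend comes first: arguments
  \<open>m\<close>, \<open>n\<close> yield \<open>n - m\<close>.\<close>

definition r_diff :: recf where "r_diff = PrimRec (Proj 0) (Comp r_pred [Proj 1])"

lemma rec_eval_diff: "rec_eval r_diff [m, n] (n - m)"
  unfolding r_diff_def
proof (rule rec_eval_PrimRec)
  show "rec_eval (Comp r_pred [Proj 1]) [k, n - k, n] (n - Suc k)" for k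
    by (rule rec_eval_Comp1[of _ _ "n - k"]) (use rec_eval_pred[of "n - k"] in \<open>auto intro!: rec_eval_Proj\<close>)
qed (auto intro!: rec_eval_Proj)

definition r_triangle :: recf where
  "r_triangle = PrimRec Zero (Comp r_add [Comp Succ [Proj 0], Proj 1])"

lemma rec_eval_triangle: "rec_eval r_triangle [n] (triangle n)"
  unfolding r_triangle_def
proof (rule rec_eval_PrimRec)
  show "rec_eval (Comp r_add [Comp Succ [Proj 0], Proj 1]) [k, triangle k] (triangle (Suc k))" for k
    by (rule rec_eval_Comp2[of _ _ "Suc k" _ "triangle k"])
      (use rec_eval_add[of "Suc k" "triangle k"] in
        \<open>auto intro!: rec_eval_Proj rec_eval_Comp1 rec_eval.Succ simp: add.commute\<close>)
qed (simp add: rec_eval.Zero)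

text \<open>Cantor pairing: \<open>prod_encode (m, n) = triangle (m + n) + m\<close>.\<close>

definition r_pair :: recf where "r_pair = Comp r_add [Comp r_triangle [r_add], Proj 0]"

lemma rec_eval_pair: "rec_eval r_pair [m, n] (prod_encode (m, n))"
  unfolding r_pair_def prod_encode_def prod.case
  by (intro rec_eval_Comp2[OF rec_eval_Comp1[OF rec_eval_add rec_eval_triangle] _ rec_eval_add] rec_eval_Proj)
    simp_all

text \<open>The weight \<open>m + n\<close> of a coded pair \<open>p = prod_encode (m, n)\<close> is the least \<open>k\<close> with
  \<open>p < triangle (Suc k)\<close>.\<close>

definition r_weight :: recf where
  "r_weight = Minim (Comp r_diff [Comp r_triangle [Comp Succ [Proj 0]], Comp Succ [Proj 1]])"

lemma mono_triangle: "m \<le> n \<Longrightarrow> triangle m \<le> triangle n"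
  by (rule lift_Suc_mono_le[of triangle]) simp_all

text \<open>With truncated subtraction, \<open>Suc p - triangle (Suc k)\<close> is zero exactly when
  \<open>p < triangle (Suc k)\<close>, and \<open>p\<close> lies between
  \<open>triangle (m + n)\<close> and \<open>triangle (Suc (m + n))\<close>, the latter
  excluded.\<close>

lemma rec_eval_weight: "rec_eval r_weight [prod_encode (m, n)] (m + n)"
proof -
  let ?p = "prod_encode (m, n)"
  let ?f = "Comp r_diff [Comp r_triangle [Comp Succ [Proj 0]], Comp Succ [Proj 1]]"
  have eval: "rec_eval ?f [k, ?p] (Suc ?p - triangle (Suc k))" for k
    by (rule rec_eval_Comp2[OF rec_eval_Comp1[OF rec_eval_Comp1 rec_eval_triangle] rec_eval_Comp1 rec_eval_diff])
      (auto intro!: rec_eval_Proj rec_eval.Succ)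
  have "Suc ?p - triangle (Suc (m + n)) = 0" by (simp add: prod_encode_def)
  then have "rec_eval ?f [m + n, ?p] 0" using eval[of "m + n"] by simp
  moreover have "\<exists>r. rec_eval ?f [k, ?p] (Suc r)" if "k < m + n" for k
  proof -
    have "triangle (Suc k) \<le> ?p"
      using mono_triangle[of "Suc k" "m + n"] that by (simp add: prod_encode_def)
    then show ?thesis using eval[of k] by (simp add: Suc_diff_le del: triangle_Suc) blast
  qed
  ultimately show ?thesis unfolding r_weight_def by (rule rec_eval.Minim)
qed

definition r_fst :: recf where "r_fst = Comp r_diff [Comp r_triangle [r_weight], Proj 0]"

lemma rec_eval_fst: "rec_eval r_fst [prod_encode (m, n)] m"
proof -
  have "rec_eval r_fst [prod_encode (m, n)] (prod_encode (m, n) - triangle (m + n))"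
    unfolding r_fst_def
    by (rule rec_eval_Comp2[OF rec_eval_Comp1[OF rec_eval_weight rec_eval_triangle] _ rec_eval_diff])
      (simp add: rec_eval_Proj)
  then show ?thesis by (simp add: prod_encode_def)
qed

definition r_snd :: recf where "r_snd = Comp r_diff [r_fst, r_weight]"

lemma rec_eval_snd: "rec_eval r_snd [prod_encode (m, n)] n"
proof -
  have "rec_eval r_snd [prod_encode (m, n)] (m + n - m)"
    unfolding r_snd_def by (rule rec_eval_Comp2[OF rec_eval_fst rec_eval_weight rec_eval_diff])
  then show ?thesis by simp
qed

section \<open>Closure properties of computable functions\<close>

text \<open>Everything is unary in a context \<open>x\<close>; a function with further arguments is
  required to be computable on tuples of the context and these arguments. The closure rules then
  follow the syntax of a HOL term, and recursive functions need not be written by hand.\<close>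

definition computable :: "('a::enc \<Rightarrow> 'b::enc) \<Rightarrow> bool" where
  "computable f \<longleftrightarrow> (\<exists>g. \<forall>x. rec_eval g [enc x] (enc (f x)))"

lemma computableI: "(\<And>x. rec_eval g [enc x] (enc (f x))) \<Longrightarrow> computable f"
  unfolding computable_def by blast

lemma computableE:
  assumes "computable f"
  obtains g where "\<And>x. rec_eval g [enc x] (enc (f x))"
  using assms unfolding computable_def by blast

named_theorems computable_intros

lemma computable_recode: "(\<And>x. enc (f x) = enc x) \<Longrightarrow> computable f"
  by (rule computableI[of "Proj 0"]) (simp add: rec_eval_Proj)

lemma computable_id [computable_intros]: "computable (\<lambda>x. x)"
  by (rule computable_recode) simp

lemma computable_compose:
  assumes "computable f" "computable g"
  shows "computable (\<lambda>x. f (g x))"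
proof -
  from assms obtain rf rg where "\<And>x. rec_eval rf [enc x] (enc (f x))" "\<And>x. rec_eval rg [enc x] (enc (g x))"
    by (metis computableE)
  then show ?thesis by (intro computableI[of "Comp rf [rg]"] rec_eval_Comp1)
qed

lemma computable_binary:
  assumes r: "\<And>x y. rec_eval r [enc x, enc y] (enc (h x y))" and "computable f" "computable g"
  shows "computable (\<lambda>x. h (f x) (g x))"
proof -
  from assms(2,3) obtain rf rg where
    "\<And>x. rec_eval rf [enc x] (enc (f x))" "\<And>x. rec_eval rg [enc x] (enc (g x))"
    by (metis computableE)
  then show ?thesis using r by (intro computableI[of "Comp r [rf, rg]"] rec_eval_Comp2)
qed

lemma computable_Suc [computable_intros]: "computable f \<Longrightarrow> computable (\<lambda>x. Suc (f x))"
  by (rule computable_compose[of Suc]) (auto intro!: computableI[of Succ] rec_eval.Succ)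

lemma computable_const [computable_intros]:
  fixes c :: "'b::enc"
  shows "computable (\<lambda>x. c)"
proof -
  have "computable (\<lambda>x. n)" for n :: nat
  proof (induction n)
    case 0
    show ?case by (rule computableI[of Zero]) (simp add: rec_eval.Zero)
  qed (rule computable_Suc)
  then have "computable (\<lambda>x. inv enc (enc c) :: 'b)"
    by (intro computable_compose[of "inv enc" "\<lambda>_. enc c"]) (auto intro: computable_recode)
  moreover have "inv enc (enc c) = c" by (simp add: bij_enc bij_is_inj)
  ultimately show ?thesis by simp
qed

lemma computable_enc [computable_intros]: "computable f \<Longrightarrow> computable (\<lambda>x. enc (f x))"
  by (rule computable_compose[of enc]) (auto intro: computable_recode)

lemma computable_inv_enc [computable_intros]: "computable f \<Longrightarrow> computable (\<lambda>x. inv enc (f x))"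
  by (rule computable_compose[of "inv enc"]) (auto intro: computable_recode)

lemma computable_Pair [computable_intros]:
  "computable f \<Longrightarrow> computable g \<Longrightarrow> computable (\<lambda>x. (f x, g x))"
  by (rule computable_binary[of r_pair]) (simp_all add: enc_prod_def rec_eval_pair)

lemma computable_fst [computable_intros]: "computable f \<Longrightarrow> computable (\<lambda>x. fst (f x))"
  by (rule computable_compose[of fst]) (auto intro!: computableI[of r_fst] simp: enc_prod_def rec_eval_fst)

lemma computable_snd [computable_intros]: "computable f \<Longrightarrow> computable (\<lambda>x. snd (f x))"
  by (rule computable_compose[of snd]) (auto intro!: computableI[of r_snd] simp: enc_prod_def rec_eval_snd)

lemma computable_add [computable_intros]:
  "computable f \<Longrightarrow> computable g \<Longrightarrow> computable (\<lambda>x. f x + g x :: nat)"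
  by (rule computable_binary[of r_add]) (simp_all add: rec_eval_add)

lemma computable_diff [computable_intros]:
  "computable f \<Longrightarrow> computable g \<Longrightarrow> computable (\<lambda>x. f x - g x :: nat)"
  by (rule computable_binary[of r_diff "\<lambda>m n. n - m"]) (simp_all add: rec_eval_diff)

lemma computable_rec_nat:
  assumes f: "computable f" and g: "computable (\<lambda>p. g (fst p) (fst (snd p)) (snd (snd p)))"
    and h: "computable h"
  shows "computable (\<lambda>x. rec_nat (f x) (g x) (h x))"
proof -
  obtain rf where rf: "\<And>x. rec_eval rf [enc x] (enc (f x))" using computableE[OF f] by blast
  obtain rg where rg: "\<And>p. rec_eval rg [enc p] (enc (g (fst p) (fst (snd p)) (snd (snd p))))"
    using computableE[OF g] by blast
  obtain rh where rh: "\<And>x. rec_eval rh [enc x] (enc (h x))" using computableE[OF h] by blast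
  \<comment> \<open>\<open>PrimRec\<close> passes counter, previous value and parameter; they are
    repacked as the tuple (parameter, counter, value).\<close>
  let ?rg = "Comp rg [Comp r_pair [Proj 2, Comp r_pair [Proj 0, Proj 1]]]"
  have "rec_eval (PrimRec rf ?rg) [n, enc x] (enc (rec_nat (f x) (g x) n))" for n x
  proof (rule rec_eval_PrimRec)
    fix n
    let ?r = "rec_nat (f x) (g x) n"
    have "rec_eval (Comp r_pair [Proj 2, Comp r_pair [Proj 0, Proj 1]]) [n, enc ?r, enc x] (enc (x, n, ?r))"
      unfolding enc_prod_def
      by (rule rec_eval_Comp2[OF _ rec_eval_Comp2[OF _ _ rec_eval_pair] rec_eval_pair])
        (auto intro: rec_eval_Proj)
    from rec_eval_Comp1[OF this rg[of "(x, n, ?r)"]]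
    show "rec_eval ?rg [n, enc ?r, enc x] (enc (rec_nat (f x) (g x) (Suc n)))" by simp
  qed (simp add: rf)
  then have "rec_eval (Comp (PrimRec rf ?rg) [rh, Proj 0]) [enc x] (enc (rec_nat (f x) (g x) (h x)))" for x
    using rh[of x] by (intro rec_eval_Comp2[of rh _ "h x"] rec_eval_Proj) simp_all
  then show ?thesis by (rule computableI)
qed

lemma funpow_eq_rec_nat: "(f ^^ n) a = rec_nat a (\<lambda>_. f) n"
  by (induction n) simp_all

lemma computable_funpow [computable_intros]:
  fixes g :: "'a::enc \<Rightarrow> 'b::enc \<Rightarrow> 'b"
  assumes "computable (\<lambda>p. g (fst p) (snd p))" "computable h" "computable f"
  shows "computable (\<lambda>x. (g x ^^ h x) (f x))"
  unfolding funpow_eq_rec_nat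
  by (rule computable_rec_nat[OF assms(3) _ assms(2)])
    (rule computable_compose[OF assms(1), of "\<lambda>p. (fst p, snd (snd p))", simplified];
      intro computable_intros)

lemma computable_mult [computable_intros]:
  assumes "computable f" "computable g"
  shows "computable (\<lambda>x. f x * g x :: nat)"
proof -
  have "m * n = ((+) n ^^ m) 0" for m n :: nat by (induction m) simp_all
  then show ?thesis using assms
    by (simp only:) (intro computable_intros computable_compose[OF assms(2)])
qed

lemma computable_power [computable_intros]:
  assumes "computable f" "computable g"
  shows "computable (\<lambda>x. f x ^ g x :: nat)"
proof -
  have "m ^ n = ((*) m ^^ n) 1" for m n :: nat by (induction n) simp_all
  then show ?thesis using assms
    by (simp only:) (intro computable_intros computable_compose[OF assms(1)])
qed

section \<open>Decidable predicates and case distinction\<close>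

definition decidable :: "('a::enc \<Rightarrow> bool) \<Rightarrow> bool" where
  "decidable P \<longleftrightarrow> computable (\<lambda>x. of_bool (P x) :: nat)"

lemma computable_if [computable_intros]:
  assumes "decidable P" "computable f" "computable g"
  shows "computable (\<lambda>x. if P x then f x else g x)"
proof -
  \<comment> \<open>A case distinction is an iteration: a constant function is applied once or not
    at all.\<close>
  have "(if P x then f x else g x) = ((\<lambda>_. f x) ^^ of_bool (P x)) (g x)" for x by simp
  then show ?thesis using assms(1)[unfolded decidable_def] assms(3)
    by (simp only:) (intro computable_intros computable_compose[OF assms(2)])
qed

lemma decidable_compose: "decidable P \<Longrightarrow> computable f \<Longrightarrow> decidable (\<lambda>x. P (f x))"
  unfolding decidable_def by (rule computable_compose)

lemma decidable_not [computable_intros]: "decidable P \<Longrightarrow> decidable (\<lambda>x. \<not> P x)"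
proof -
  have "of_bool (\<not> P x) = 1 - (of_bool (P x) :: nat)" for x by simp
  then show "decidable P \<Longrightarrow> ?thesis"
    unfolding decidable_def by (simp only:) (intro computable_intros)
qed

lemma decidable_conj [computable_intros]:
  "decidable P \<Longrightarrow> decidable Q \<Longrightarrow> decidable (\<lambda>x. P x \<and> Q x)"
  unfolding decidable_def of_bool_conj by (intro computable_intros)

lemma decidable_eq [computable_intros]:
  assumes "computable f" "computable g"
  shows "decidable (\<lambda>x. f x = g x)"
proof -
  \<comment> \<open>With truncated subtraction the two differences are both zero only for equal
    numbers; codes are compared in place of values.\<close>
  have "of_bool (m = n) = 1 - ((m - n) + (n - m))" for m n :: nat
    by (cases m n rule: linorder_cases) auto
  from this[of "enc (f _)" "enc (g _)"]
  have "of_bool (f x = g x) = 1 - ((enc (f x) - enc (g x)) + (enc (g x) - enc (f x)))" for x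
    by simp
  then show ?thesis unfolding decidable_def using assms by (simp only:) (intro computable_intros)
qed

section \<open>List functions\<close>

lemma computable_Cons [computable_intros]:
  assumes "computable f" "computable g"
  shows "computable (\<lambda>x. f x # g x)"
proof -
  have "computable (\<lambda>x. inv enc (Suc (enc (f x, g x))) :: 'b list)"
    using assms by (intro computable_intros)
  moreover have "inv enc (Suc (enc (f x, g x))) = f x # g x" for x
    by (rule inv_f_eq[OF bij_is_inj[OF bij_enc]]) (simp add: enc_Cons enc_prod_def)
  ultimately show ?thesis by simp
qed

text \<open>The empty list has code 0 and \<open>y # ys\<close> has the successor of the code of the
  pair \<open>(y, ys)\<close>. On the empty list \<open>?uncons\<close> decodes to an arbitrary
  pair, which the conditional discards.\<close>

lemma computable_case_list:
  fixes l :: "'a::enc \<Rightarrow> 'b::enc list"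
  assumes "computable l" "computable f" "computable (\<lambda>p. g (fst p) (fst (snd p)) (snd (snd p)))"
  shows "computable (\<lambda>x. case l x of [] \<Rightarrow> f x | y # ys \<Rightarrow> g x y ys)"
proof -
  let ?uncons = "\<lambda>x. inv enc (enc (l x) - Suc 0) :: 'b \<times> 'b list"
  have "(case l x of [] \<Rightarrow> f x | y # ys \<Rightarrow> g x y ys) =
      (if enc (l x) = 0 then f x
       else g x (fst (?uncons x)) (snd (?uncons x)))" for x
  proof (cases "l x")
    case (Cons y ys)
    have "?uncons x = (y, ys)"
      by (rule inv_f_eq[OF bij_is_inj[OF bij_enc]]) (simp add: Cons enc_Cons enc_prod_def)
    with Cons show ?thesis by (simp add: enc_Cons)
  qed simp
  moreover have "computable (\<lambda>x. g x (fst (?uncons x)) (snd (?uncons x)))"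
    by (rule computable_compose[OF assms(3), of "\<lambda>x. (x, ?uncons x)", simplified])
      (use assms(1) in \<open>intro computable_intros\<close>)
  ultimately show ?thesis using assms(1,2) by (simp only:) (intro computable_intros)
qed

lemma length_le_enc: "length xs \<le> enc xs"
proof (induction xs)
  case (Cons x xs)
  then show ?case using le_prod_encode_2[of "enc xs" "enc x"] by (simp add: enc_Cons)
qed simp

text \<open>Recursion on lists becomes iteration on the pair of accumulator and remaining list. The
  code of the list is a sufficient number of steps, as it is at least the length and steps on an
  empty remainder change nothing.\<close>

lemma computable_fold:
  assumes f: "computable (\<lambda>p. f (fst p) (fst (snd p)) (snd (snd p)))" and l: "computable l"
    and a: "computable a"
  shows "computable (\<lambda>x. fold (f x) (l x) (a x))"
proof -
  let ?step = "\<lambda>x s. case snd s of [] \<Rightarrow> s | y # ys \<Rightarrow> (f x y (fst s), ys)"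
  have "(?step x ^^ n) (s, ys) = (fold (f x) ys s, [])" if "length ys \<le> n" for x n s ys
    using that
  proof (induction n arbitrary: s ys)
    case (Suc n)
    then show ?case
      by (cases ys) (simp_all add: funpow_swap1 del: funpow.simps(2) add: funpow_Suc_right)
  qed simp
  then have "fold (f x) (l x) (a x) = fst ((?step x ^^ enc (l x)) (a x, l x))" for x
    using length_le_enc[of "l x"] by simp
  moreover have "computable (\<lambda>p. ?step (fst p) (snd p))"
  proof (intro computable_case_list computable_intros)
    show "computable (\<lambda>x. f (fst (fst x)) (fst (snd x)) (fst (snd (fst x))))"
      by (rule computable_compose[OF f, of "\<lambda>x. (fst (fst x), fst (snd x), fst (snd (fst x)))", simplified])
        (intro computable_intros)
  qed
  ultimately show ?thesis using l a by (simp only:) (intro computable_intros)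
qed

lemma computable_foldr [computable_intros]:
  assumes f: "computable (\<lambda>p. f (fst p) (fst (snd p)) (snd (snd p)))" and l: "computable l"
    and a: "computable a"
  shows "computable (\<lambda>x. foldr (f x) (l x) (a x))"
  unfolding foldr_conv_fold rev_conv_fold
  by (intro computable_fold[OF f] computable_fold[of "\<lambda>_. Cons"] computable_intros l a)

lemma computable_map [computable_intros]:
  assumes f: "computable (\<lambda>p. f (fst p) (snd p))" and l: "computable l"
  shows "computable (\<lambda>x. map (f x) (l x))"
proof -
  have "map g xs = foldr (\<lambda>y ys. g y # ys) xs []" for g :: "'b \<Rightarrow> 'c" and xs
    by (induction xs) simp_all
  then show ?thesis
    by (simp only:) (intro computable_intros l
      computable_compose[OF f, of "\<lambda>p. (fst p, fst (snd p))", simplified])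
qed

lemma computable_filter [computable_intros]:
  assumes P: "decidable (\<lambda>p. P (fst p) (snd p))" and l: "computable l"
  shows "computable (\<lambda>x. filter (P x) (l x))"
proof -
  have "filter Q xs = foldr (\<lambda>y ys. if Q y then y # ys else ys) xs []" for Q :: "'b \<Rightarrow> bool" and xs
    by (induction xs) simp_all
  then show ?thesis
    by (simp only:) (intro computable_intros l
      decidable_compose[OF P, of "\<lambda>p. (fst p, fst (snd p))", simplified])
qed

lemma computable_append [computable_intros]:
  assumes "computable f" "computable g"
  shows "computable (\<lambda>x. f x @ g x)"
proof -
  have "xs @ ys = foldr (#) xs ys" for xs ys :: "'b list"
    by (induction xs) simp_all
  then show ?thesis using assms by (simp only:) (intro computable_intros)
qed

lemma computable_concat [computable_intros]:
  assumes "computable f"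
  shows "computable (\<lambda>x. concat (f x))"
  unfolding concat_conv_foldr using assms by (intro computable_intros)

lemma computable_length [computable_intros]:
  assumes "computable f"
  shows "computable (\<lambda>x. length (f x))"
proof -
  have "length xs = foldr (\<lambda>_. Suc) xs 0" for xs :: "'b list"
    by (induction xs) simp_all
  then show ?thesis using assms by (simp only:) (intro computable_intros)
qed

lemma decidable_Ball [computable_intros]:
  assumes P: "decidable (\<lambda>p. P (fst p) (snd p))" and l: "computable l"
  shows "decidable (\<lambda>x. \<forall>y\<in>set (l x). P x y)"
proof -
  have "of_bool (\<forall>y\<in>set xs. Q y) = foldr (\<lambda>y b. if Q y then b else 0) xs (1::nat)"
    for Q :: "'b \<Rightarrow> bool" and xs
    by (induction xs) simp_all
  then show ?thesis unfolding decidable_def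
    by (simp only:) (intro computable_intros l
      decidable_compose[OF P, of "\<lambda>p. (fst p, fst (snd p))", simplified])
qed

lemma decidable_Bex [computable_intros]:
  assumes P: "decidable (\<lambda>p. P (fst p) (snd p))" and l: "computable l"
  shows "decidable (\<lambda>x. \<exists>y\<in>set (l x). P x y)"
proof -
  have "(\<exists>y\<in>set (l x). P x y) \<longleftrightarrow> \<not> (\<forall>y\<in>set (l x). \<not> P x y)" for x by blast
  then show ?thesis using assms by (simp only:) (intro computable_intros)
qed

lemma decidable_mem [computable_intros]:
  assumes "computable f" "computable l"
  shows "decidable (\<lambda>x. f x \<in> set (l x))"
proof -
  have "f x \<in> set (l x) \<longleftrightarrow> (\<exists>y\<in>set (l x). y = f x)" for x by blast
  then show ?thesis using assms
    by (simp only:) (intro computable_intros computable_compose[OF assms(1)])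
qed

lemma computable_upt [computable_intros]:
  assumes "computable f"
  shows "computable (\<lambda>x. [0..<f x])"
proof -
  have "[0..<n] = rec_nat [] (\<lambda>k ks. ks @ [k]) n" for n by (induction n) simp_all
  then show ?thesis using assms by (simp only:) (intro computable_rec_nat computable_intros)
qed

lemma computable_subseqs [computable_intros]:
  assumes "computable f"
  shows "computable (\<lambda>x. subseqs (f x))"
proof -
  have "subseqs xs = foldr (\<lambda>y yss. map ((#) y) yss @ yss) xs [[]]" for xs :: "'b list"
    by (induction xs) (simp_all add: Let_def)
  then show ?thesis using assms by (simp only:) (intro computable_intros)
qed

lemma computable_n_lists [computable_intros]:
  assumes "computable f" "computable g"
  shows "computable (\<lambda>x. List.n_lists (f x) (g x))"
proof -
  have "List.n_lists n xs = ((\<lambda>yss. concat (map (\<lambda>ys. map (\<lambda>y. y # ys) xs) yss)) ^^ n) [[]]"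
    for n and xs :: "'b list"
    by (induction n) simp_all
  then show ?thesis using assms
    by (simp only:) (intro computable_intros computable_compose[OF assms(2)])
qed

section \<open>Binary digits\<close>

lemma computable_div_mod_2:
  assumes "computable f"
  shows "computable (\<lambda>x. (f x div 2, f x mod 2 :: nat))"
proof -
  have "(n div 2, n mod 2) = ((\<lambda>p. if snd p = 0 then (fst p, 1) else (Suc (fst p), 0)) ^^ n) (0 :: nat, 0 :: nat)"
    for n :: nat
    by (induction n) (auto simp: mod_Suc div_Suc prod_eq_iff split: if_splits)
  then show ?thesis using assms by (simp only:) (intro computable_intros)
qed

lemma computable_div_2 [computable_intros]: "computable f \<Longrightarrow> computable (\<lambda>x. f x div 2 :: nat)"
  using computable_fst[OF computable_div_mod_2] by simp

lemma decidable_even [computable_intros]: "computable f \<Longrightarrow> decidable (\<lambda>x. even (f x :: nat))"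
  using decidable_eq[OF computable_snd[OF computable_div_mod_2] computable_const[of 0]]
  by (simp add: even_iff_mod_2_eq_zero)

lemma computable_div_power_2 [computable_intros]:
  assumes "computable f" "computable g"
  shows "computable (\<lambda>x. f x div 2 ^ g x :: nat)"
proof -
  have "m div 2 ^ n = ((\<lambda>m. m div 2) ^^ n) m" for m n :: nat
    by (induction n) (simp_all add: power_Suc2 div_mult2_eq del: power_Suc)
  then show ?thesis using assms by (simp only:) (intro computable_intros)
qed

text \<open>The function is the unbounded search for the least \<open>k\<close>. Decidability makes
  every test on the way defined, so the search halts whenever some \<open>k\<close> exists.\<close>

lemma recursively_enumerable_projection:
  fixes R :: "nat \<Rightarrow> nat \<Rightarrow> bool"
  assumes "decidable (\<lambda>p. R (fst p) (snd p))"
  shows "recursively_enumerable {n. \<exists>k. R n k}"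
proof -
  have "computable (\<lambda>p. of_bool (\<not> R (fst p) (snd p)) :: nat)"
    using decidable_not[OF assms] unfolding decidable_def .
  then obtain g where "\<And>p. rec_eval g [enc p] (enc (of_bool (\<not> R (fst p) (snd p)) :: nat))"
    by (rule computableE) blast
  from this[of "(_, _)"] have g: "rec_eval g [prod_encode (n, k)] (of_bool (\<not> R n k))" for n k
    by (simp add: enc_prod_def)
  \<comment> \<open>The arguments are swapped because minimization acts on the first one.\<close>
  let ?g = "Comp g [Comp r_pair [Proj 1, Proj 0]]"
  have eval: "rec_eval ?g [k, n] (of_bool (\<not> R n k))" for n k
    by (rule rec_eval_Comp1[OF rec_eval_Comp2[OF _ _ rec_eval_pair] g]) (auto intro: rec_eval_Proj)
  have "(\<exists>k. R n k) \<longleftrightarrow> (\<exists>y. rec_eval (Minim ?g) [n] y)" for n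
  proof
    assume "\<exists>k. R n k"
    then obtain k where k: "R n k" "\<And>j. j < k \<Longrightarrow> \<not> R n j"
      using exists_least_iff[of "R n"] by blast
    have "rec_eval (Minim ?g) [n] k"
    proof (rule rec_eval.Minim)
      show "rec_eval ?g [k, n] 0" using eval[of k n] k(1) by simp
      show "\<exists>r. rec_eval ?g [j, n] (Suc r)" if "j < k" for j
        using eval[of j n] k(2)[OF that] by auto
    qed
    then show "\<exists>y. rec_eval (Minim ?g) [n] y" ..
  next
    assume "\<exists>y. rec_eval (Minim ?g) [n] y"
    then obtain y where "rec_eval (Minim ?g) [n] y" ..
    then have "rec_eval ?g [y, n] 0" by (rule rec_evalE(7))
    then have "of_bool (\<not> R n y) = (0::nat)" using rec_eval_functional eval by blast
    then show "\<exists>k. R n k" by auto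
  qed
  then show ?thesis unfolding recursively_enumerable_def by auto
qed

section \<open>Deciding stabilization\<close>

text \<open>A finite list acts as a total substitution with default 0. Lists of length
  \<open>N\<close> are used, and all variables of the program are below \<open>N\<close>, so the
  default is never read.\<close>

definition lookup :: "nat list \<Rightarrow> nat \<Rightarrow> nat" where
  "lookup s x = (case (tl ^^ x) s of [] \<Rightarrow> 0 | c # _ \<Rightarrow> c)"

lemma lookup_nth: "x < length s \<Longrightarrow> lookup s x = s ! x"
proof (induction x arbitrary: s)
  case 0
  then show ?case by (cases s) (simp_all add: lookup_def)
next
  case (Suc x)
  then show ?case by (cases s) (simp_all add: lookup_def funpow_swap1)
qed

definition assignments :: "nat \<Rightarrow> nat \<Rightarrow> nat list list" where
  "assignments N M = List.n_lists N [0..<M]"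

definition derive_once :: "rule list \<Rightarrow> nat list list \<Rightarrow> fact list \<Rightarrow> fact list \<Rightarrow> fact list" where
  "derive_once rs ss D I = D @ concat (map (\<lambda>r. map (\<lambda>s. ground (lookup s) (head r))
     (filter (\<lambda>s. \<forall>a\<in>set (body r). ground (lookup s) a \<in> set I) ss)) rs)"

definition stage_list :: "rule list \<Rightarrow> nat list list \<Rightarrow> fact list \<Rightarrow> nat \<Rightarrow> fact list" where
  "stage_list rs ss D k = (derive_once rs ss D ^^ k) D"

definition edb_base :: "rule list \<Rightarrow> nat list list \<Rightarrow> fact list" where
  "edb_base rs ss = filter (\<lambda>F. fact_sym F \<notin> idb (set rs))
     (concat (map (\<lambda>r. concat (map (\<lambda>a. map (\<lambda>s. ground (lookup s) a) ss) (body r))) rs))"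

text \<open>The right-hand side of \<open>stabilizes_at_iff_canonical\<close>, with subsequences of
  a list standing for subsets of the finite set of candidate facts.\<close>

definition stabilization_check :: "nat \<Rightarrow> rule list \<Rightarrow> nat \<Rightarrow> bool" where
  "stabilization_check N rs k \<longleftrightarrow>
     (\<forall>D\<in>set (subseqs (edb_base rs (assignments N (width N (Suc k))))).
      \<forall>F\<in>set (stage_list rs (assignments N (width N (Suc k))) D (Suc k)).
        F \<in> set (stage_list rs (assignments N (width N (Suc k))) D k))"

lemma set_assignments: "set (assignments N M) = {s. length s = N \<and> set s \<subseteq> {..<M}}"
  by (auto simp: assignments_def set_n_lists)

lemma ground_cong:
  "(\<And>x. Var x \<in> set (args a) \<Longrightarrow> \<sigma> x = \<tau> x) \<Longrightarrow> ground \<sigma> a = ground \<tau> a"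
proof -
  assume eq: "\<And>x. Var x \<in> set (args a) \<Longrightarrow> \<sigma> x = \<tau> x"
  have "tm_val \<sigma> t = tm_val \<tau> t" if "t \<in> set (args a)" for t
    by (cases t) (use eq that in auto)
  then show ?thesis by (simp add: ground_def)
qed

text \<open>Composition with this retraction turns an arbitrary substitution into one with values
  below \<open>M\<close>.\<close>

definition retract :: "nat \<Rightarrow> nat \<Rightarrow> nat" where
  "retract M c = (if c < M then c else 0)"

lemma fmap_retract: "F \<in> facts_over M \<Longrightarrow> fmap (retract M) F = F"
  by (rule fmap_idI) (auto simp: retract_def facts_over_def)

context
  fixes N M :: nat and rs :: "rule list"
  assumes rs: "bounded_by N (set rs)" and NM: "N \<le> M" and M: "M > 0"
begin

lemma ground_lookup_over:
  assumes "s \<in> set (assignments N M)" "r \<in> set rs" "a = head r \<or> a \<in> set (body r)"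
  shows "ground (lookup s) a \<in> facts_over M"
proof -
  have "tm_val (lookup s) t < M" if t: "t \<in> set (args a)" for t
  proof (cases t)
    case (Var x)
    then have x: "x < length s"
      using bounded_byD(3)[OF rs assms(2,3)] t assms(1) by (simp add: set_assignments)
    then have "s ! x \<in> set s" by (rule nth_mem)
    moreover have "set s \<subseteq> {..<M}" using assms(1) by (simp add: set_assignments)
    ultimately have "s ! x < M" by blast
    then show ?thesis using Var x by (simp add: lookup_nth)
  next
    case (Const c)
    then show ?thesis using bounded_byD(4)[OF rs assms(2,3)] t NM by fastforce
  qed
  then show ?thesis by (auto simp: facts_over_def ground_def)
qed

text \<open>The retraction fixes the constants of the program because \<open>N \<le> M\<close>, and
  the first \<open>N\<close> values determine the substitution on every atom of the program.\<close>

lemma ground_retract: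
  assumes "r \<in> set rs" "a = head r \<or> a \<in> set (body r)"
  shows "ground (lookup (map (\<lambda>x. retract M (\<sigma> x)) [0..<N])) a = fmap (retract M) (ground \<sigma> a)"
proof -
  have "fmap (retract M) (ground \<sigma> a) = ground (retract M \<circ> \<sigma>) a"
  proof (rule fmap_ground)
    fix c assume "Const c \<in> set (args a)"
    then have "c < M" using bounded_byD(4)[OF rs assms] NM by fastforce
    then show "retract M c = c" by (simp add: retract_def)
  qed
  also have "\<dots> = ground (lookup (map (\<lambda>x. retract M (\<sigma> x)) [0..<N])) a"
    by (rule ground_cong) (use bounded_byD(3)[OF rs assms] in \<open>simp add: lookup_nth\<close>)
  finally show ?thesis ..
qed

lemma retract_assignment: "map (\<lambda>x. retract M (\<sigma> x)) [0..<N] \<in> set (assignments N M)"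
  using M by (auto simp: set_assignments retract_def)

lemma stage_list_Suc:
  "F \<in> set (stage_list rs ss D (Suc k)) \<longleftrightarrow> F \<in> set D \<or> (\<exists>r\<in>set rs. \<exists>s\<in>set ss.
     (\<forall>a\<in>set (body r). ground (lookup s) a \<in> set (stage_list rs ss D k)) \<and>
     F = ground (lookup s) (head r))"
  by (simp add: stage_list_def derive_once_def) blast

lemma stage_list_sound:
  assumes "set D \<subseteq> facts_over M"
  shows "F \<in> set (stage_list rs (assignments N M) D k) \<Longrightarrow> F \<in> stage (set rs) (set D) k \<inter> facts_over M"
proof (induction k arbitrary: F)
  case 0
  then show ?case using assms by (auto simp: stage_list_def)
next
  case (Suc k)
  then consider "F \<in> set D" | r s where "r \<in> set rs" "s \<in> set (assignments N M)"
      "\<forall>a\<in>set (body r). ground (lookup s) a \<in> set (stage_list rs (assignments N M) D k)"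
      "F = ground (lookup s) (head r)"
    unfolding stage_list_Suc by blast
  then show ?case
  proof cases
    case 1
    then show ?thesis using assms by auto
  next
    case 2
    have "F \<in> stage (set rs) (set D) (Suc k)"
      unfolding 2(4) by (rule stage_SucI[OF 2(1)]) (use 2(3) Suc.IH in blast)
    then show ?thesis using ground_lookup_over[OF 2(2,1)] 2(4) by blast
  qed
qed

text \<open>Even for an instance and a conclusion over \<open>M\<close>, unsafe rules can bring
  larger constants into the intermediate facts. Replaying the derivation through
  \<open>retract M\<close>, which fixes the instance, removes them.\<close>

lemma stage_list_complete:
  assumes "set D \<subseteq> facts_over M"
  shows "F \<in> stage (set rs) (set D) k \<Longrightarrow> fmap (retract M) F \<in> set (stage_list rs (assignments N M) D k)"
proof (induction k arbitrary: F)
  case 0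
  then show ?case using assms fmap_retract[of F M] by (auto simp: stage_list_def)
next
  case (Suc k)
  show ?case
  proof (cases "F \<in> set D")
    case True
    then have "fmap (retract M) F \<in> set D" using assms fmap_retract[of F M] by auto
    then show ?thesis unfolding stage_list_Suc by blast
  next
    case False
    from stage_SucE[OF Suc.prems this] obtain r \<sigma> where r: "r \<in> set rs" "F = ground \<sigma> (head r)"
      and b: "\<And>a. a \<in> set (body r) \<Longrightarrow> ground \<sigma> a \<in> stage (set rs) (set D) k" by metis
    let ?s = "map (\<lambda>x. retract M (\<sigma> x)) [0..<N]"
    have "\<forall>a\<in>set (body r). ground (lookup ?s) a \<in> set (stage_list rs (assignments N M) D k)"
      using ground_retract[OF r(1)] Suc.IH[OF b] by simp
    moreover have "fmap (retract M) F = ground (lookup ?s) (head r)"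
      using ground_retract[OF r(1)] r(2) by simp
    ultimately show ?thesis unfolding stage_list_Suc using r(1) retract_assignment by blast
  qed
qed

lemma set_stage_list:
  assumes "set D \<subseteq> facts_over M"
  shows "set (stage_list rs (assignments N M) D k) = stage (set rs) (set D) k \<inter> facts_over M"
proof (intro equalityI subsetI)
  fix F assume "F \<in> stage (set rs) (set D) k \<inter> facts_over M"
  then show "F \<in> set (stage_list rs (assignments N M) D k)"
    using stage_list_complete[OF assms, of F k] fmap_retract[of F M] by simp
qed (rule stage_list_sound[OF assms])

lemma set_edb_base:
  "set (edb_base rs (assignments N M)) =
    {F \<in> body_instances (set rs) \<inter> facts_over M. fact_sym F \<notin> idb (set rs)}"
proof (intro equalityI subsetI)
  fix F assume "F \<in> set (edb_base rs (assignments N M))"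
  then obtain r a s where "r \<in> set rs" "a \<in> set (body r)" "s \<in> set (assignments N M)"
    "F = ground (lookup s) a" "fact_sym F \<notin> idb (set rs)"
    by (auto simp: edb_base_def)
  then show "F \<in> {F \<in> body_instances (set rs) \<inter> facts_over M. fact_sym F \<notin> idb (set rs)}"
    using ground_lookup_over[of s r a] unfolding body_instances_def by blast
next
  fix F assume F: "F \<in> {F \<in> body_instances (set rs) \<inter> facts_over M. fact_sym F \<notin> idb (set rs)}"
  then obtain \<sigma> r a where r: "r \<in> set rs" "a \<in> set (body r)" "F = ground \<sigma> a"
    unfolding body_instances_def by blast
  have "F = ground (lookup (map (\<lambda>x. retract M (\<sigma> x)) [0..<N])) a"
    using ground_retract[OF r(1), of a \<sigma>] r(2,3) fmap_retract[of F M] F by simp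
  then have "\<exists>s\<in>set (assignments N M). F = ground (lookup s) a" using retract_assignment by blast
  then show "F \<in> set (edb_base rs (assignments N M))"
    using F r(1,2) by (auto simp: edb_base_def)
qed

end

lemma stabilization_check_iff:
  assumes rs: "bounded_by N (set rs)" and N: "N > 0"
  shows "stabilization_check N rs k \<longleftrightarrow> stabilizes_at (set rs) k"
proof -
  define M where "M = width N (Suc k)"
  have M: "N \<le> M" "M > 0" using N by (simp_all add: M_def width_def)
  let ?ss = "assignments N M" and ?P = "set rs"
  let ?B = "set (edb_base rs ?ss)"
  have B: "?B = {F \<in> body_instances ?P \<inter> facts_over M. fact_sym F \<notin> idb ?P}"
    by (rule set_edb_base[OF rs M])
  have "stabilization_check N rs k \<longleftrightarrow>
      (\<forall>E\<in>set ` set (subseqs (edb_base rs ?ss)). stage ?P E (Suc k) \<inter> facts_over M \<subseteq> stage ?P E k)"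
    unfolding stabilization_check_def M_def[symmetric] ball_simps
  proof (rule ball_cong[OF refl])
    fix D assume "D \<in> set (subseqs (edb_base rs ?ss))"
    then have "set D \<in> Pow ?B" unfolding subseqs_powset[symmetric] by (rule imageI)
    then have "set D \<subseteq> facts_over M" using B by blast
    from set_stage_list[OF rs M this] show
      "(\<forall>F\<in>set (stage_list rs ?ss D (Suc k)). F \<in> set (stage_list rs ?ss D k)) \<longleftrightarrow>
        stage ?P (set D) (Suc k) \<inter> facts_over M \<subseteq> stage ?P (set D) k"
      by (simp only:) blast
  qed
  also have "\<dots> \<longleftrightarrow> (\<forall>E. edb_instance ?P E \<and> E \<subseteq> body_instances ?P \<inter> facts_over M \<longrightarrow>
       stage ?P E (Suc k) \<inter> facts_over M \<subseteq> stage ?P E k)"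
  proof -
    have "E \<in> set ` set (subseqs (edb_base rs ?ss)) \<longleftrightarrow>
        edb_instance ?P E \<and> E \<subseteq> body_instances ?P \<inter> facts_over M" for E
    proof -
      have "E \<subseteq> ?B \<Longrightarrow> finite E" by (rule finite_subset[OF _ finite_set])
      then show ?thesis unfolding subseqs_powset edb_instance_def using B by blast
    qed
    then show ?thesis unfolding Ball_def by (simp only:)
  qed
  also have "\<dots> \<longleftrightarrow> stabilizes_at ?P k"
    by (rule stabilizes_at_iff_canonical[OF rs N M_def, symmetric])
  finally show ?thesis .
qed

section \<open>Computability of the test\<close>

lemma computable_tl [computable_intros]:
  assumes "computable f"
  shows "computable (\<lambda>x. tl (f x))"
  unfolding tl_def using assms by (intro computable_case_list computable_intros)

lemma computable_lookup [computable_intros]: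
  assumes "computable f" "computable g"
  shows "computable (\<lambda>x. lookup (f x) (g x))"
  unfolding lookup_def using assms by (intro computable_case_list computable_intros)

lemma computable_atom_pair: "computable (\<lambda>a. (aname a, args a))"
  by (rule computable_recode) (simp add: enc_atom_def)

lemma computable_aname [computable_intros]: "computable f \<Longrightarrow> computable (\<lambda>x. aname (f x))"
  using computable_fst[OF computable_compose[OF computable_atom_pair]] by simp

lemma computable_args [computable_intros]: "computable f \<Longrightarrow> computable (\<lambda>x. args (f x))"
  using computable_snd[OF computable_compose[OF computable_atom_pair]] by simp

lemma computable_rule_pair: "computable (\<lambda>r. (head r, body r))"
  by (rule computable_recode) (simp add: enc_rule_def)

lemma computable_head [computable_intros]: "computable f \<Longrightarrow> computable (\<lambda>x. head (f x))"
  using computable_fst[OF computable_compose[OF computable_rule_pair]] by simp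

lemma computable_body [computable_intros]: "computable f \<Longrightarrow> computable (\<lambda>x. body (f x))"
  using computable_snd[OF computable_compose[OF computable_rule_pair]] by simp

text \<open>\<open>sum_encode\<close> sends \<open>Inl x\<close> to \<open>2 * x\<close> and
  \<open>Inr c\<close> to \<open>2 * c + 1\<close>, so parity separates variables from
  constants.\<close>

lemma tm_val_eq_enc: "tm_val \<sigma> t = (if even (enc t) then \<sigma> (enc t div 2) else enc t div 2)"
  by (cases t) (simp_all add: enc_tm_def sum_encode_def)

lemma computable_ground [computable_intros]:
  assumes "computable f" "computable g"
  shows "computable (\<lambda>x. ground (lookup (f x)) (g x))"
  unfolding ground_def tm_val_eq_enc
  by (intro computable_intros assms computable_compose[OF assms(1)])

lemma computable_atom_sym [computable_intros]:
  "computable f \<Longrightarrow> computable (\<lambda>x. atom_sym (f x))"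
  unfolding atom_sym_def by (intro computable_intros)

lemma computable_fact_sym [computable_intros]:
  "computable f \<Longrightarrow> computable (\<lambda>x. fact_sym (f x))"
  unfolding fact_sym_def by (intro computable_intros)

lemma decidable_idb [computable_intros]:
  assumes "computable f" "computable g"
  shows "decidable (\<lambda>x. f x \<in> idb (set (g x)))"
proof -
  have "q \<in> idb (set rs) \<longleftrightarrow> (\<exists>r\<in>set rs. body r \<noteq> [] \<and> atom_sym (head r) = q)" for q rs
    unfolding idb_def by blast
  then show ?thesis
    by (simp only:) (intro computable_intros assms computable_compose[OF assms(1)])
qed

lemma computable_edb_base [computable_intros]:
  assumes "computable f" "computable g"
  shows "computable (\<lambda>x. edb_base (f x) (g x))"
  unfolding edb_base_def
  by (intro computable_intros assms computable_compose[OF assms(1)] computable_compose[OF assms(2)])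

lemma computable_derive_once:
  "computable (\<lambda>p. derive_once (fst p) (fst (snd p)) (fst (snd (snd p))) (snd (snd (snd p))))"
  unfolding derive_once_def by (intro computable_intros)

lemma computable_stage_list [computable_intros]:
  assumes "computable f" "computable g" "computable d" "computable h"
  shows "computable (\<lambda>x. stage_list (f x) (g x) (d x) (h x))"
  unfolding stage_list_def
proof (intro computable_funpow assms)
  show "computable (\<lambda>p. derive_once (f (fst p)) (g (fst p)) (d (fst p)) (snd p))"
    by (rule computable_compose[OF computable_derive_once,
          of "\<lambda>p. (f (fst p), g (fst p), d (fst p), snd p)", simplified])
      (intro computable_intros assms[THEN computable_compose])
qed

lemma decidable_stabilization_check:
  "decidable (\<lambda>p. stabilization_check (fst p) (fst (snd p)) (snd (snd p)))"
  unfolding stabilization_check_def assignments_def width_def by (intro computable_intros)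

section \<open>Decoding of program codes\<close>

text \<open>The rule codes are the positions of the binary digits 1 of \<open>n\<close>; such a
  position \<open>i\<close> satisfies \<open>2 ^ i \<le> n\<close>, so searching below
  \<open>n\<close> finds all of them.\<close>

definition rules_of_code :: "nat \<Rightarrow> rule list" where
  "rules_of_code n = map (inv enc) (filter (\<lambda>i. odd (n div 2 ^ i)) [0..<n])"

lemma computable_rules_of_code: "computable rules_of_code"
  unfolding rules_of_code_def[abs_def] by (intro computable_intros)

lemma set_decode_less: "i \<in> set_decode n \<Longrightarrow> i < n"
proof -
  assume "i \<in> set_decode n"
  then have "odd (n div 2 ^ i)" by (simp add: set_decode_def)
  then have "0 < n div 2 ^ i" by (rule odd_pos)
  then have "2 ^ i \<le> n" by (simp add: div_greater_zero_iff)
  then show ?thesis using less_exp[of i] by linarith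
qed

lemma set_rules_of_code: "set (rules_of_code n) = inv enc ` set_decode n"
proof -
  have "{i. i < n \<and> odd (n div 2 ^ i)} = set_decode n"
    using set_decode_less[of _ n] unfolding set_decode_def by blast
  then show ?thesis by (simp add: rules_of_code_def)
qed

lemma program_code_rules_of_code: "program_code (set (rules_of_code n)) = n"
  by (simp add: program_code_def set_rules_of_code rule_code_eq_enc image_comp comp_def)

lemma enc_less_if_mem: "x \<in> set xs \<Longrightarrow> enc x < enc xs"
proof (induction xs)
  case (Cons y ys)
  then show ?case
    using le_prod_encode_1[of "enc y" "enc ys"] le_prod_encode_2[of "enc ys" "enc y"]
    by (auto simp: enc_Cons)
qed simp

text \<open>Pair and list codes are at least as large as the codes of their components, and each
  rule has a code below \<open>n\<close>, so \<open>n\<close> bounds all parameters. The successor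
  makes the bound positive, as the canonical test requires.\<close>

lemma bounded_by_rules_of_code: "bounded_by (Suc n) (set (rules_of_code n))"
  unfolding bounded_by_def
proof (intro ballI conjI)
  fix r assume "r \<in> set (rules_of_code n)"
  then obtain i where i: "i \<in> set_decode n" "r = inv enc i" unfolding set_rules_of_code by blast
  then have r: "enc r < n" using set_decode_less by simp
  have "enc (head r) \<le> enc r" and body: "enc (body r) \<le> enc r"
    unfolding enc_rule_def enc_prod_def by (simp_all add: le_prod_encode_1 le_prod_encode_2)
  then show "length (body r) \<le> Suc n" using length_le_enc[of "body r"] r by linarith
  fix a assume "a \<in> insert (head r) (set (body r))"
  then have "enc a \<le> enc r"
    using \<open>enc (head r) \<le> enc r\<close> body enc_less_if_mem[of a "body r"] by auto
  moreover have "enc (args a) \<le> enc a"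
    unfolding enc_atom_def enc_prod_def by (simp add: le_prod_encode_2)
  ultimately have args: "enc (args a) < n" using r by linarith
  then show "length (args a) \<le> Suc n" using length_le_enc[of "args a"] by linarith
  fix t assume "t \<in> set (args a)"
  then have "enc t < n" using enc_less_if_mem args by fastforce
  then show "(case t of Var x \<Rightarrow> x | Const c \<Rightarrow> c) < Suc n"
    by (cases t) (auto simp: enc_tm_def sum_encode_def)
qed

theorem corollary4p8:
  "recursively_enumerable (program_code ` {P. datalog_program P \<and> bounded_program P})"
proof -
  have check: "bounded_program (set (rules_of_code n)) \<longleftrightarrow>
      (\<exists>k. stabilization_check (Suc n) (rules_of_code n) k)" for n
    using stabilization_check_iff[OF bounded_by_rules_of_code]
    by (simp add: bounded_iff_stabilizes)
  have "program_code ` {P. datalog_program P \<and> bounded_program P} =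
      {n. bounded_program (set (rules_of_code n))}"
  proof (intro equalityI subsetI)
    fix n assume "n \<in> program_code ` {P. datalog_program P \<and> bounded_program P}"
    then obtain P where P: "datalog_program P" "bounded_program P" "n = program_code P" by blast
    \<comment> \<open>Both are finite programs with code \<open>n\<close>, and coding is injective
      on finite programs.\<close>
    have "set (rules_of_code n) = P"
      by (rule inj_onD[OF inj_on_program_code])
        (use P in \<open>simp_all add: program_code_rules_of_code datalog_program_def\<close>)
    with P show "n \<in> {n. bounded_program (set (rules_of_code n))}" by simp
  next
    fix n assume "n \<in> {n. bounded_program (set (rules_of_code n))}"
    then show "n \<in> program_code ` {P. datalog_program P \<and> bounded_program P}"
      by (intro image_eqI[of _ _ "set (rules_of_code n)"])
        (simp_all add: program_code_rules_of_code datalog_program_def)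
  qed
  also have "\<dots> = {n. \<exists>k. stabilization_check (Suc n) (rules_of_code n) k}"
    by (simp only: check)
  finally show ?thesis
  proof (simp only:, intro recursively_enumerable_projection)
    show "decidable (\<lambda>p. stabilization_check (Suc (fst p)) (rules_of_code (fst p)) (snd p))"
      by (rule decidable_compose[OF decidable_stabilization_check,
            of "\<lambda>p. (Suc (fst p), rules_of_code (fst p), snd p)", simplified])
        (intro computable_intros computable_compose[OF computable_rules_of_code])
  qed
qed

end
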